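(* Let $\mathbf{x} = (x_1,\ldots,x_n)$ and let $P \in \mathbb{C}[\mathbf{x}]$ be a homogeneous polynomial of degree $d$ which is computable by an arithmetic circuit of size $s$. Then, for every $t \in \{1,\ldots,d\}$, there is a depth-$3$ ($\sum\prod\sum$) circuit $C_t \in \mathbb{C}(\varepsilon)[\mathbf{x}]$ of top fan-in at most $s^{O(t)}$ and formal degree $s^{O(d/t)}$ such that $$C_t \equiv P + \varepsilon\, Q,$$ where $Q \in \mathbb{C}[\varepsilon,\mathbf{x}]$ and every monomial with a non-zero coefficient in $Q$ has degree strictly greater than $d$.
   Context: An arithmetic circuit on variables $\mathbf{x}$ over a field $\mathbb{F}$ is a directed acyclic graph whose leaves are labeled by variables in $\mathbf{x}$ and constants in $\mathbb{F}$ and whose internal vertices are labeled by sum $(+)$ or product $(\times)$; each vertex computes a polynomial in the natural way, and the circuit computes the polynomial at its output vertex. Its size is the size of this graph (the number of its vertices and edges). The circuit computing $P$ is over $\mathbb{C}$. $\varepsilon$ is a formal variable independent of $\mathbf{x}$, and $\mathbb{C}(\varepsilon)$ is the field of rational functions in $\varepsilon$. A depth-$3$ ($\sum\prod\sum$) circuit is an arithmetic circuit whose internal gates are arranged in three layers of alternating sums and products, the top layer being a sum; it represents a polynomial as a sum of products of affine forms (polynomials of degree at most $1$ in $\mathbf{x}$). Here the coefficients of the affine forms lie in $\mathbb{C}(\varepsilon)$. Its top fan-in is the fan-in of the top sum gate (the number of products being summed), and its formal degree is the maximum of the degrees of its product gates. The degree of a monomial of $Q$ means its degree in $\mathbf{x}$,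 and $\equiv$ denotes equality of polynomials in $\mathbf{x}$ over $\mathbb{C}(\varepsilon)$. The notation $O(\cdot)$ hides absolute constants.
   Formalization: The formal degree bound proved is max(d, s^{O(d/t)}) instead of s^{O(d/t)}; the literal bound fails for P = x_1^{2^k} with t = d, which has circuits of size O(k) but needs formal degree at least d = 2^k. *)

theory Defs
  imports
    Complex_Main
    "HOL-Library.Poly_Mapping"
    "HOL-Computational_Algebra.Polynomial_Factorial"
    "Graph_Theory.Digraph"
begin

type_synonym monomial = "nat \<Rightarrow>\<^sub>0 nat"
type_synonym 'a mpoly = "monomial \<Rightarrow>\<^sub>0 'a"

definition mdeg :: "monomial \<Rightarrow> nat" where
  "mdeg m = (\<Sum>i\<in>Poly_Mapping.keys m. Poly_Mapping.lookup m i)"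

definition mpoly_const :: "'a::comm_ring_1 \<Rightarrow> 'a mpoly" where
  "mpoly_const a = Poly_Mapping.single 0 a"

definition mpoly_var :: "nat \<Rightarrow> 'a::comm_ring_1 mpoly" where
  "mpoly_var i = Poly_Mapping.single (Poly_Mapping.single i 1) 1"

text \<open>Polynomials in the variables with indices \<open>1, \<dots>, n\<close>.\<close>

definition mpolys :: "nat \<Rightarrow> 'a::comm_ring_1 mpoly set" where
  "mpolys n = {p. \<forall>m\<in>Poly_Mapping.keys p. Poly_Mapping.keys m \<subseteq> {1..n}}"

text \<open>As usual, the zero polynomial is homogeneous of every degree.\<close>

definition homogeneous :: "nat \<Rightarrow> 'a::comm_ring_1 mpoly \<Rightarrow> bool" where
  "homogeneous d p \<longleftrightarrow> (\<forall>m\<in>Poly_Mapping.keys p. mdeg m = d)"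

definition affine_form :: "nat \<Rightarrow> 'a::comm_ring_1 mpoly \<Rightarrow> bool" where
  "affine_form n p \<longleftrightarrow> p \<in> mpolys n \<and> (\<forall>m\<in>Poly_Mapping.keys p. mdeg m \<le> 1)"


datatype 'a gate = Const 'a | Var nat | Plus | Times

text \<open>
  Arcs point from a gate's inputs to the gate. Parallel arcs are allowed, so that an
  input may be used repeatedly by one gate; each of them counts in the size. Fan-in
  and fan-out are unbounded.
\<close>

record 'a circuit =
  dag :: "(nat, nat) pre_digraph"
  gate_at :: "nat \<Rightarrow> 'a gate"
  out :: nat

definition arithmetic_circuit :: "nat \<Rightarrow> 'a circuit \<Rightarrow> bool" where
  "arithmetic_circuit n \<Gamma> \<longleftrightarrow>
     fin_digraph (dag \<Gamma>) \<and> acyclic (arcs_ends (dag \<Gamma>)) \<and> out \<Gamma> \<in> verts (dag \<Gamma>) \<and>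
     (\<forall>v\<in>verts (dag \<Gamma>).
        if in_arcs (dag \<Gamma>) v = {}
        then (\<exists>a. gate_at \<Gamma> v = Const a) \<or> (\<exists>i\<in>{1..n}. gate_at \<Gamma> v = Var i)
        else gate_at \<Gamma> v \<in> {Plus, Times})"

definition circuit_size :: "'a circuit \<Rightarrow> nat" where
  "circuit_size \<Gamma> = card (verts (dag \<Gamma>)) + card (arcs (dag \<Gamma>))"

fun gate_poly :: "'a::comm_ring_1 circuit \<Rightarrow> (nat \<Rightarrow> 'a mpoly) \<Rightarrow> nat \<Rightarrow> 'a gate \<Rightarrow> 'a mpoly" where
  "gate_poly \<Gamma> f v (Const a) = mpoly_const a"
| "gate_poly \<Gamma> f v (Var i) = mpoly_var i"
| "gate_poly \<Gamma> f v Plus = (\<Sum>e\<in>in_arcs (dag \<Gamma>) v. f (tail (dag \<Gamma>) e))"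
| "gate_poly \<Gamma> f v Times = (\<Prod>e\<in>in_arcs (dag \<Gamma>) v. f (tail (dag \<Gamma>) e))"

text \<open>
  \<open>f\<close> assigns to every vertex the polynomial computed there. On an acyclic graph
  these equations determine \<open>f\<close> uniquely on the vertices.
\<close>

definition computes :: "'a::comm_ring_1 circuit \<Rightarrow> 'a mpoly \<Rightarrow> bool" where
  "computes \<Gamma> p \<longleftrightarrow>
     (\<exists>f. (\<forall>v\<in>verts (dag \<Gamma>). f v = gate_poly \<Gamma> f v (gate_at \<Gamma> v)) \<and> f (out \<Gamma>) = p)"


text \<open>
  A depth-3 circuit is given by the list of its product gates, each of them by the
  list of the affine forms that it multiplies. The degree of a product gate is the
  number of its factors, so constant factors count as well; this is an upper bound
  for the degree of the product as a polynomial.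
\<close>

type_synonym 'a depth3 = "'a mpoly list list"

definition depth3_circuit :: "nat \<Rightarrow> 'a::comm_ring_1 depth3 \<Rightarrow> bool" where
  "depth3_circuit n C \<longleftrightarrow> (\<forall>g\<in>set C. \<forall>l\<in>set g. affine_form n l)"

definition depth3_poly :: "'a::comm_ring_1 depth3 \<Rightarrow> 'a mpoly" where
  "depth3_poly C = (\<Sum>g\<leftarrow>C. prod_list g)"

definition top_fanin :: "'a depth3 \<Rightarrow> nat" where
  "top_fanin C = length C"

definition formal_degree :: "'a depth3 \<Rightarrow> nat" where
  "formal_degree C = Max (insert 0 (length ` set C))"


text \<open>
  The field \<open>\<complex>(\<epsilon>)\<close> is \<^typ>\<open>complex poly fract\<close>; \<open>\<complex>[\<epsilon>,x]\<close> is
  \<^typ>\<open>complex poly mpoly\<close>.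
\<close>

definition eps :: "complex poly fract" where
  "eps = to_fract [:0, 1:]"

definition lift_const :: "complex mpoly \<Rightarrow> complex poly fract mpoly" where
  "lift_const p = Poly_Mapping.map (\<lambda>a. to_fract [:a:]) p"

definition lift_eps :: "complex poly mpoly \<Rightarrow> complex poly fract mpoly" where
  "lift_eps q = Poly_Mapping.map to_fract q"

text \<open>
  The bound \<open>s\<^bsup>O(d/t)\<^esup>\<close> on the formal degree can only be meant with the proviso that it
  is at least \<open>d\<close>: the degree-\<open>d\<close> part of \<open>P + \<epsilon>Q\<close> is \<open>P\<close>, so for \<open>P \<noteq> 0\<close> every
  depth-3 circuit for \<open>P + \<epsilon>Q\<close> has formal degree at least \<open>d\<close>, whereas repeated squaring
  gives circuits of size \<open>O(log d)\<close> for \<open>x\<^sub>1\<^bsup>d\<^esup>\<close>, \<open>d\<close> a power of \<open>2\<close>. Hence the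
  bound is stated as \<open>max d (s\<^bsup>b*d/t\<^esup>)\<close>. When \<open>d\<close> is polynomially bounded in \<open>s\<close>,
  the maximum is \<open>s\<^bsup>O(d/t)\<^esup>\<close> again, because \<open>d/t \<ge> 1\<close>.
\<close>

end

theory Submission
  imports Defs "HOL-Library.FuncSet" "HOL-Computational_Algebra.Fundamental_Theorem_Algebra"
begin

text \<open>
  A homogeneous \<open>R\<close> of degree \<open>e\<close> is a combination \<open>\<Sum> c\<^sub>b L\<^sub>b\<^sup>e\<close> of powers of linear
  forms, and \<open>\<Prod>(1 + c\<^sub>b \<epsilon>\<^sup>e L\<^sub>b\<^sup>e) = 1 + \<epsilon>\<^sup>e R + \<dots>\<close>, where the omitted terms are divisible by
  \<open>\<epsilon>\<^bsup>2e\<^esup>\<close> and have degree at least \<open>2e\<close>. Each factor on the left splits over \<open>\<complex>\<close> into \<open>e\<close> affine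
  forms, so subtracting \<open>1\<close> and dividing by \<open>\<epsilon>\<^sup>e\<close> approximates \<open>R\<close> with top fan-in 2
  (Kumar). These approximations can be multiplied and added.

  When \<open>d \<le> s\<^sup>4\<close>, depth reduction writes \<open>P\<close> as a sum of \<open>s\<^bsup>O(t)\<^esup>\<close> products of \<open>O(t)\<close> homogeneous
  polynomials of degree \<open>O(d/t)\<close>, each of which is a combination of \<open>s\<^bsup>O(d/t)\<^esup>\<close> powers of linear
  forms. When \<open>d > s\<^sup>4\<close>, no circuit is needed, only that \<open>P\<close> has at most \<open>s\<close> variables: there
  are at most \<open>(d+1)\<^sup>s \<le> s\<^bsup>O(\<surd>d)\<^esup>\<close> monomials and as many powers of linear forms, so the sum of
  monomials works for \<open>t \<ge> \<surd>d\<close> and the approximation of \<open>P\<close> itself for \<open>t < \<surd>d\<close>.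
\<close>

section \<open>Polynomials with prescribed monomials\<close>

text \<open>Bounds on variables, homogeneity and degree bounds all become membership in
  \<open>supp S\<close> for a suitable \<open>S\<close>, so that one product rule,
  \<open>supp_mult\<close>, serves them all.\<close>

definition supp :: "monomial set \<Rightarrow> 'a::comm_ring_1 mpoly set" where
  "supp S = {p. Poly_Mapping.keys p \<subseteq> S}"

lemma supp_mono: "S \<subseteq> S' \<Longrightarrow> supp S \<subseteq> supp S'"
  by (auto simp: supp_def)

lemma supp_0 [simp]: "0 \<in> supp S"
  by (simp add: supp_def)

lemma supp_add: "p \<in> supp S \<Longrightarrow> q \<in> supp S \<Longrightarrow> p + q \<in> supp S"
  unfolding supp_def using keys_add[of p q] by blast

lemma supp_sum: "(\<And>x. x \<in> A \<Longrightarrow> f x \<in> supp S) \<Longrightarrow> sum f A \<in> supp S"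
  by (induction A rule: infinite_finite_induct) (auto intro: supp_add)

lemma supp_single: "m \<in> S \<Longrightarrow> Poly_Mapping.single m a \<in> supp S"
  by (simp add: supp_def)

lemma supp_mult:
  assumes "p \<in> supp A" "q \<in> supp B" "\<And>a b. a \<in> A \<Longrightarrow> b \<in> B \<Longrightarrow> a + b \<in> C"
  shows "p * q \<in> supp C"
  using assms keys_mult[of p q] unfolding supp_def by blast

lemma mpoly_eq_sum_single:
  fixes p :: "'a \<Rightarrow>\<^sub>0 'b::comm_monoid_add"
  shows "p = (\<Sum>m\<in>Poly_Mapping.keys p. Poly_Mapping.single m (Poly_Mapping.lookup p m))"
proof (rule poly_mapping_eqI)
  fix k
  have "(\<Sum>m\<in>Poly_Mapping.keys p. Poly_Mapping.lookup p m when m = k) =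
        (\<Sum>m\<in>Poly_Mapping.keys p. if k = m then Poly_Mapping.lookup p m else 0)"
    by (rule sum.cong) (auto simp: when_def)
  then show "Poly_Mapping.lookup p k = Poly_Mapping.lookup
      (\<Sum>m\<in>Poly_Mapping.keys p. Poly_Mapping.single m (Poly_Mapping.lookup p m)) k"
    by (simp add: lookup_sum lookup_single in_keys_iff)
qed

lemma mpoly_induct [case_names zero single add]:
  fixes p :: "'a \<Rightarrow>\<^sub>0 'b::comm_monoid_add"
  assumes "P 0" "\<And>m a. P (Poly_Mapping.single m a)" "\<And>p q. P p \<Longrightarrow> P q \<Longrightarrow> P (p + q)"
  shows "P p"
proof -
  have "P (\<Sum>m\<in>M. Poly_Mapping.single m (Poly_Mapping.lookup p m))" if "finite M" for M
    using that by induction (use assms in auto)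
  then show ?thesis
    by (subst mpoly_eq_sum_single) simp
qed

lemma mpoly_const_add: "mpoly_const (a + b) = mpoly_const a + mpoly_const b"
  by (simp add: mpoly_const_def single_add)

lemma mpoly_const_mult: "mpoly_const (a * b) = mpoly_const a * mpoly_const b"
  by (simp add: mpoly_const_def mult_single)

lemma mpoly_const_0 [simp]: "mpoly_const 0 = 0"
  by (simp add: mpoly_const_def)

lemma mpoly_const_1 [simp]: "mpoly_const 1 = 1"
  by (simp add: mpoly_const_def)

lemma mpoly_const_uminus: "mpoly_const (- a) = - mpoly_const a"
  by (simp add: mpoly_const_def single_uminus)

lemma mpoly_const_power: "mpoly_const (a ^ n) = mpoly_const a ^ n"
  by (induction n) (auto simp: mpoly_const_mult)

lemma mpoly_const_of_nat: "mpoly_const (of_nat n) = of_nat n"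
  by (induction n) (auto simp: mpoly_const_add)

lemma mdeg_eq_sum: "finite A \<Longrightarrow> Poly_Mapping.keys m \<subseteq> A \<Longrightarrow> mdeg m = (\<Sum>i\<in>A. Poly_Mapping.lookup m i)"
  unfolding mdeg_def by (rule sum.mono_neutral_left) (auto simp: in_keys_iff)

lemma mdeg_0 [simp]: "mdeg 0 = 0"
  by (simp add: mdeg_def)

lemma mdeg_add: "mdeg (a + b) = mdeg a + mdeg b"
proof -
  let ?A = "Poly_Mapping.keys a \<union> Poly_Mapping.keys b"
  have "mdeg (a + b) = (\<Sum>i\<in>?A. Poly_Mapping.lookup (a + b) i)"
    by (rule mdeg_eq_sum) (auto dest: keys_add[THEN subsetD])
  also have "\<dots> = mdeg a + mdeg b"
    by (subst (1 2) mdeg_eq_sum[of ?A]) (auto simp: lookup_add sum.distrib)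
  finally show ?thesis .
qed

lemma mdeg_single [simp]: "mdeg (Poly_Mapping.single i k) = k"
  by (cases "k = 0") (auto simp: mdeg_def)

lemma mdeg_eq_0_iff: "mdeg m = 0 \<longleftrightarrow> m = 0"
  by (auto simp: mdeg_def in_keys_iff poly_mapping_eqI)

lemma keys_add_nat: "Poly_Mapping.keys ((a :: monomial) + b) = Poly_Mapping.keys a \<union> Poly_Mapping.keys b"
  by (auto simp: in_keys_iff lookup_add)

text \<open>\<open>V\<close> will be the set of variables that occur in the circuit:
  \<open>card V\<close> is bounded by the circuit size, while \<open>n\<close> is not.\<close>

definition over :: "nat set \<Rightarrow> monomial set" where
  "over V = {m. Poly_Mapping.keys m \<subseteq> V}"

definition mons :: "nat set \<Rightarrow> nat \<Rightarrow> monomial set" where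
  "mons V d = {m \<in> over V. mdeg m = d}"

definition mons_le :: "nat set \<Rightarrow> nat \<Rightarrow> monomial set" where
  "mons_le V d = {m \<in> over V. mdeg m \<le> d}"

definition mons_ge :: "nat set \<Rightarrow> nat \<Rightarrow> monomial set" where
  "mons_ge V d = {m \<in> over V. mdeg m \<ge> d}"

lemmas mons_defs = over_def mons_def mons_le_def mons_ge_def

lemma mpolys_eq: "mpolys n = supp (over {1..n})"
  by (auto simp: mpolys_def supp_def over_def)

lemma over_mult: "p \<in> supp (over V) \<Longrightarrow> q \<in> supp (over V) \<Longrightarrow> p * q \<in> supp (over V)"
  by (rule supp_mult) (auto simp: mons_defs keys_add_nat)

lemma mons_mult: "p \<in> supp (mons V i) \<Longrightarrow> q \<in> supp (mons V j) \<Longrightarrow> p * q \<in> supp (mons V (i + j))"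
  by (rule supp_mult) (auto simp: mons_defs keys_add_nat mdeg_add)

lemma mons_ge_mult:
  "p \<in> supp (mons_ge V i) \<Longrightarrow> q \<in> supp (mons_ge V j) \<Longrightarrow> k \<le> i + j \<Longrightarrow> p * q \<in> supp (mons_ge V k)"
  by (rule supp_mult) (auto simp: mons_defs keys_add_nat mdeg_add)

lemma mpoly_const_supp: "0 \<in> S \<Longrightarrow> mpoly_const a \<in> supp S"
  by (auto simp: mpoly_const_def intro: supp_single)

lemma zero_mons [simp]: "0 \<in> over V" "0 \<in> mons V 0" "0 \<in> mons_le V k" "0 \<in> mons_ge V 0"
  by (auto simp: mons_defs)

lemma one_supp: "0 \<in> S \<Longrightarrow> 1 \<in> supp S"
  using mpoly_const_supp[of S 1] by simp

lemma supp_scale: "p \<in> supp S \<Longrightarrow> mpoly_const a * p \<in> supp S"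
  by (rule supp_mult[where A = "{0}"]) (auto intro: mpoly_const_supp)

lemma mpoly_var_supp: "i \<in> V \<Longrightarrow> mpoly_var i \<in> supp (mons V 1)"
  by (auto simp: mpoly_var_def mons_defs intro!: supp_single)

lemma mons_imp_mons_le: "p \<in> supp (mons V e) \<Longrightarrow> e \<le> k \<Longrightarrow> p \<in> supp (mons_le V k)"
  by (rule subsetD[OF supp_mono]) (auto simp: mons_defs)

lemma mons_imp_mons_ge: "p \<in> supp (mons V e) \<Longrightarrow> k \<le> e \<Longrightarrow> p \<in> supp (mons_ge V k)"
  by (rule subsetD[OF supp_mono]) (auto simp: mons_defs)

lemma power_mons: "p \<in> supp (mons V i) \<Longrightarrow> p ^ k \<in> supp (mons V (i * k))"
proof (induction k)
  case (Suc k)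
  then show ?case
    using mons_mult[of p V i "p ^ k" "i * k"] by simp
qed (auto intro: one_supp)

lemma mons_0_const: "p \<in> supp (mons V 0) \<Longrightarrow> \<exists>a. p = mpoly_const a"
proof -
  assume "p \<in> supp (mons V 0)"
  then have k: "Poly_Mapping.keys p \<subseteq> {0}"
    by (auto simp: supp_def mons_defs mdeg_eq_0_iff)
  then have "p = mpoly_const (Poly_Mapping.lookup p 0)"
    unfolding mpoly_const_def
    by (intro poly_mapping_eqI) (auto simp: lookup_single when_def in_keys_iff)
  then show ?thesis by blast
qed

section \<open>Counting monomials by degree and by number of variables\<close>

lemma mons_Suc_split:
  assumes m: "m \<in> mons V (Suc e)"
  shows "\<exists>m'\<in>mons V e. \<exists>i\<in>V. m = m' + Poly_Mapping.single i 1"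
proof -
  have "m \<noteq> 0" using m by (auto simp: mons_defs)
  then obtain i where i: "i \<in> Poly_Mapping.keys m"
    using keys_eq_empty by blast
  define m' where "m' = m - Poly_Mapping.single i 1"
  have eq: "m = m' + Poly_Mapping.single i 1"
    using i unfolding m'_def
    by (intro poly_mapping_eqI) (auto simp: lookup_add lookup_minus lookup_single when_def in_keys_iff)
  have "m' \<in> mons V e" "i \<in> V"
    using m by (auto simp: mons_defs eq mdeg_add keys_add_nat)
  then show ?thesis using eq by blast
qed

text \<open>A monomial of degree \<open>e + 1\<close> is one of degree \<open>e\<close> times a
  variable, so each degree costs a factor \<open>card V + 1\<close>. This is the good count for
  small degrees.\<close>

lemma finite_card_mons_le_length:
  assumes "finite V"
  shows "finite (mons_le V e) \<and> card (mons_le V e) \<le> (card V + 1) ^ e"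
proof (induction e)
  case 0
  have "mons_le V 0 = {0}" by (auto simp: mons_defs mdeg_eq_0_iff)
  then show ?case by simp
next
  case (Suc e)
  let ?f = "\<lambda>(m :: monomial, i). m + Poly_Mapping.single i 1"
  have sub: "mons_le V (Suc e) \<subseteq> mons_le V e \<union> ?f ` (mons_le V e \<times> V)"
  proof
    fix m assume m: "m \<in> mons_le V (Suc e)"
    show "m \<in> mons_le V e \<union> ?f ` (mons_le V e \<times> V)"
    proof (cases "mdeg m = Suc e")
      case True
      then have "m \<in> mons V (Suc e)" using m by (auto simp: mons_defs)
      then obtain m' i where m': "m' \<in> mons V e" "i \<in> V" "m = m' + Poly_Mapping.single i 1"
        using mons_Suc_split by blast
      then have "(m', i) \<in> mons_le V e \<times> V" by (auto simp: mons_defs)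
      then have "m \<in> ?f ` (mons_le V e \<times> V)"
        by (rule rev_image_eqI) (simp add: m')
      then show ?thesis by blast
    next
      case False
      then show ?thesis using m by (auto simp: mons_defs)
    qed
  qed
  have "card (mons_le V (Suc e)) \<le> card (mons_le V e \<union> ?f ` (mons_le V e \<times> V))"
    using Suc assms by (intro card_mono sub) auto
  also have "\<dots> \<le> card (mons_le V e) + card (mons_le V e \<times> V)"
    using Suc assms by (intro order_trans[OF card_Un_le] add_mono card_image_le) auto
  also have "\<dots> = card (mons_le V e) * (card V + 1)"
    by (simp add: card_cartesian_product)
  also have "\<dots> \<le> (card V + 1) ^ e * (card V + 1)"
    using Suc by (intro mult_right_mono) auto
  finally show ?case
    using finite_subset[OF sub] Suc assms by (simp add: mult.commute)
qed

lemma finite_mons_le: "finite V \<Longrightarrow> finite (mons_le V e)"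
  using finite_card_mons_le_length[of V e] by simp

lemma finite_mons: "finite V \<Longrightarrow> finite (mons V e)"
  by (rule finite_subset[OF _ finite_mons_le[of V e]]) (auto simp: mons_defs)

text \<open>Every exponent lies in \<open>{0..e}\<close>. This is the good count when the degree is
  large compared with the number of variables.\<close>

lemma card_mons_le_box:
  assumes "finite V"
  shows "card (mons_le V e) \<le> (e + 1) ^ card V"
proof -
  let ?r = "\<lambda>m. restrict (Poly_Mapping.lookup m) V"
  have inj: "inj_on ?r (mons_le V e)"
  proof (rule inj_onI, rule poly_mapping_eqI)
    fix m m' k assume mm: "m \<in> mons_le V e" "m' \<in> mons_le V e" and eq: "?r m = ?r m'"
    show "Poly_Mapping.lookup m k = Poly_Mapping.lookup m' k"
    proof (cases "k \<in> V")
      case True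
      then show ?thesis using fun_cong[OF eq, of k] by simp
    next
      case False
      then have "k \<notin> Poly_Mapping.keys m" "k \<notin> Poly_Mapping.keys m'"
        using mm by (auto simp: mons_defs)
      then show ?thesis by (simp add: in_keys_iff)
    qed
  qed
  have sub: "?r ` mons_le V e \<subseteq> PiE V (\<lambda>_. {..e})"
  proof (clarsimp simp: image_subset_iff)
    fix m i assume m: "m \<in> mons_le V e" and i: "i \<in> V"
    have "Poly_Mapping.lookup m i \<le> (\<Sum>j\<in>V. Poly_Mapping.lookup m j)"
      using assms i by (intro member_le_sum) auto
    also have "\<dots> = mdeg m"
      using m assms by (intro mdeg_eq_sum[symmetric]) (auto simp: mons_defs)
    finally show "Poly_Mapping.lookup m i \<le> e"
      using m by (auto simp: mons_defs)
  qed
  have "card (mons_le V e) = card (?r ` mons_le V e)"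
    using inj by (simp add: card_image)
  also have "\<dots> \<le> card (PiE V (\<lambda>_. {..e}))"
    using assms by (intro card_mono sub finite_PiE) auto
  also have "\<dots> = (e + 1) ^ card V"
    using assms by (simp add: card_PiE)
  finally show ?thesis .
qed

text \<open>Here the base is \<open>card V\<close> itself: a single variable admits at most one
  monomial, which the case \<open>s = 1\<close> of the theorem relies on.\<close>

lemma card_mons_length:
  assumes "finite V"
  shows "card (mons V e) \<le> card V ^ e"
proof (induction e)
  case 0
  have "mons V 0 = {0}" by (auto simp: mons_defs mdeg_eq_0_iff)
  then show ?case by simp
next
  case (Suc e)
  let ?f = "\<lambda>(m :: monomial, i). m + Poly_Mapping.single i 1"
  have sub: "mons V (Suc e) \<subseteq> ?f ` (mons V e \<times> V)"
    using mons_Suc_split by fastforce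
  have "card (mons V (Suc e)) \<le> card (?f ` (mons V e \<times> V))"
    using assms finite_mons by (intro card_mono sub) auto
  also have "\<dots> \<le> card (mons V e \<times> V)"
    using assms finite_mons by (intro card_image_le) auto
  also have "\<dots> \<le> card V ^ e * card V"
    using Suc by (simp add: card_cartesian_product)
  finally show ?case by (simp add: mult.commute)
qed

section \<open>Homogeneous components\<close>

definition hc :: "nat \<Rightarrow> 'a::comm_ring_1 mpoly \<Rightarrow> 'a mpoly" where
  "hc i p = Poly_Mapping.mapp (\<lambda>m a. a when mdeg m = i) p"

lemma lookup_hc: "Poly_Mapping.lookup (hc i p) m = (Poly_Mapping.lookup p m when mdeg m = i)"
  by (auto simp: hc_def lookup_mapp when_def in_keys_iff)

lemma hc_add: "hc i (p + q) = hc i p + hc i q"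
  by (rule poly_mapping_eqI) (auto simp: lookup_hc lookup_add when_def)

lemma hc_0 [simp]: "hc i 0 = 0"
  by (rule poly_mapping_eqI) (auto simp: lookup_hc)

lemma hc_sum: "hc i (sum f A) = (\<Sum>x\<in>A. hc i (f x))"
  by (induction A rule: infinite_finite_induct) (auto simp: hc_add)

lemma hc_single: "hc i (Poly_Mapping.single m a) = (if mdeg m = i then Poly_Mapping.single m a else 0)"
  by (rule poly_mapping_eqI) (auto simp: lookup_hc lookup_single when_def)

lemma hc_supp: "p \<in> supp (over V) \<Longrightarrow> hc i p \<in> supp (mons V i)"
  by (force simp: supp_def mons_defs in_keys_iff lookup_hc)

lemma hc_homogeneous: "p \<in> supp (mons V j) \<Longrightarrow> hc i p = (if i = j then p else 0)"
  by (intro poly_mapping_eqI) (force simp: supp_def mons_defs in_keys_iff lookup_hc when_def)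

lemma hc_mult_single:
  "hc i (Poly_Mapping.single a x * Poly_Mapping.single b y) =
    (\<Sum>j\<le>i. hc j (Poly_Mapping.single a x) * hc (i - j) (Poly_Mapping.single b y))"
proof -
  have "(\<Sum>j\<le>i. hc j (Poly_Mapping.single a x) * hc (i - j) (Poly_Mapping.single b y)) =
     (\<Sum>j\<le>i. if j = mdeg a then (if mdeg a + mdeg b = i then Poly_Mapping.single (a + b) (x * y) else 0) else 0)"
    by (rule sum.cong) (auto simp: hc_single mult_single)
  also have "\<dots> = hc i (Poly_Mapping.single a x * Poly_Mapping.single b y)"
    by (auto simp: hc_single mult_single mdeg_add)
  finally show ?thesis ..
qed

lemma hc_mult: "hc i (p * q) = (\<Sum>j\<le>i. hc j p * hc (i - j) q)"
proof (induction p rule: mpoly_induct)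
  case (single a x)
  show ?case
  proof (induction q rule: mpoly_induct)
    case (single b y)
    show ?case by (rule hc_mult_single)
  qed (auto simp: hc_add algebra_simps sum.distrib)
qed (auto simp: hc_add algebra_simps sum.distrib)

text \<open>With one factor homogeneous, a single component of the other factor \<open>p\<close>,
  which may be arbitrary, contributes. The test \<open>j \<le> i\<close> guards the truncated
  subtraction.\<close>

lemma hc_mult_homogeneous:
  assumes "g \<in> supp (mons V j)"
  shows "hc i (p * g) = (if j \<le> i then hc (i - j) p * g else 0)"
proof -
  have "hc i (p * g) = (\<Sum>k\<le>i. if k + j = i then hc k p * g else 0)"
    unfolding hc_mult by (rule sum.cong) (auto simp: hc_homogeneous[OF assms])
  also have "\<dots> = (\<Sum>k\<le>i. if k = i - j then (if j \<le> i then hc k p * g else 0) else 0)"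
    by (rule sum.cong) auto
  finally show ?thesis by auto
qed

section \<open>Linear combinations with restricted coefficients\<close>

text \<open>Two coefficient sets occur: the constants, for powers of linear forms and for gates, and
  all polynomials over \<open>V\<close>, for cofactors of which nothing else is recorded.\<close>

definition rspan :: "'a::comm_ring_1 set \<Rightarrow> 'a set \<Rightarrow> 'a set" where
  "rspan R B = {p. \<exists>Y. (\<forall>g\<in>B. Y g \<in> R) \<and> p = (\<Sum>g\<in>B. Y g * g)}"

definition closed_ring :: "'a::comm_ring_1 set \<Rightarrow> bool" where
  "closed_ring R \<longleftrightarrow> 0 \<in> R \<and> 1 \<in> R \<and> (\<forall>x\<in>R. \<forall>y\<in>R. x + y \<in> R \<and> x * y \<in> R)"

lemma rspan_0: "closed_ring R \<Longrightarrow> 0 \<in> rspan R B"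
  unfolding rspan_def closed_ring_def by (force intro: exI[of _ "\<lambda>_. 0"])

lemma rspan_add:
  assumes "closed_ring R" "p \<in> rspan R B" "q \<in> rspan R B"
  shows "p + q \<in> rspan R B"
proof -
  obtain Y Z where "\<forall>g\<in>B. Y g \<in> R" "p = (\<Sum>g\<in>B. Y g * g)" "\<forall>g\<in>B. Z g \<in> R" "q = (\<Sum>g\<in>B. Z g * g)"
    using assms unfolding rspan_def by blast
  then show ?thesis
    using assms(1) unfolding rspan_def closed_ring_def
    by (auto intro!: exI[of _ "\<lambda>g. Y g + Z g"] simp: sum.distrib algebra_simps)
qed

lemma rspan_scale:
  assumes "closed_ring R" "r \<in> R" "p \<in> rspan R B"
  shows "r * p \<in> rspan R B"
proof -
  obtain Y where "\<forall>g\<in>B. Y g \<in> R" "p = (\<Sum>g\<in>B. Y g * g)"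
    using assms unfolding rspan_def by blast
  then show ?thesis
    using assms(1,2) unfolding rspan_def closed_ring_def
    by (auto intro!: exI[of _ "\<lambda>g. r * Y g"] simp: sum_distrib_left algebra_simps)
qed

lemma rspan_sum:
  "closed_ring R \<Longrightarrow> (\<And>x. x \<in> A \<Longrightarrow> f x \<in> rspan R B) \<Longrightarrow> sum f A \<in> rspan R B"
  by (induction A rule: infinite_finite_induct) (auto intro: rspan_add rspan_0)

lemma rspan_base:
  assumes "closed_ring R" "finite B" "g \<in> B"
  shows "g \<in> rspan R B"
proof -
  have "(\<Sum>x\<in>B. (if x = g then 1 else 0) * x) = (\<Sum>x\<in>B. if x = g then x else 0)"
    by (rule sum.cong) auto
  then have "g = (\<Sum>x\<in>B. (if x = g then 1 else 0) * x)"
    using assms by simp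
  then show ?thesis
    using assms(1) unfolding rspan_def closed_ring_def
    by (auto intro!: exI[of _ "\<lambda>x. if x = g then 1 else 0"])
qed

lemma rspan_trans:
  assumes "closed_ring R" "p \<in> rspan R B" "\<And>g. g \<in> B \<Longrightarrow> g \<in> rspan R B'"
  shows "p \<in> rspan R B'"
proof -
  obtain Y where Y: "\<forall>g\<in>B. Y g \<in> R" "p = (\<Sum>g\<in>B. Y g * g)"
    using assms unfolding rspan_def by blast
  show ?thesis
    unfolding Y(2) using Y(1) assms by (intro rspan_sum rspan_scale) auto
qed

lemma rspan_mono:
  assumes "closed_ring R" "finite B'" "B \<subseteq> B'" "p \<in> rspan R B"
  shows "p \<in> rspan R B'"
  using assms by (intro rspan_trans[OF assms(1,4)] rspan_base) auto

lemma closed_ring_consts: "closed_ring (range mpoly_const)"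
  unfolding closed_ring_def
  by (auto simp flip: mpoly_const_add mpoly_const_mult mpoly_const_0 mpoly_const_1)

lemma closed_ring_over: "closed_ring (supp (over V))"
  unfolding closed_ring_def by (auto intro: supp_add over_mult one_supp)

section \<open>Homogeneous polynomials as combinations of powers of linear forms\<close>

text \<open>The iterated finite difference of \<open>g\<close> in the directions \<open>ys\<close>,
  the tool for polarization: unfolded, it is a signed sum of values of \<open>g\<close> at
  \<open>z\<close> plus subset sums of \<open>ys\<close>.\<close>

fun fdiff :: "('a::comm_ring_1 \<Rightarrow> 'a) \<Rightarrow> 'a list \<Rightarrow> 'a \<Rightarrow> 'a" where
  "fdiff g [] z = g z"
| "fdiff g (y # ys) z = fdiff g ys (z + y) - fdiff g ys z"

text \<open>Difference operators commute, so the first difference can be moved onto the function,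
  where it lowers the degree.\<close>

lemma fdiff_Cons: "fdiff g (y # ys) z = fdiff (\<lambda>z. g (z + y) - g z) ys z"
proof (induction ys arbitrary: z)
  case (Cons x ys)
  show ?case
    using Cons[of z] Cons[of "z + x"] by (simp add: algebra_simps)
qed simp

lemma fdiff_sum: "fdiff (\<lambda>z. \<Sum>j\<in>A. c j * g j z) ys z = (\<Sum>j\<in>A. c j * fdiff (g j) ys z)"
  by (induction ys arbitrary: z) (auto simp: algebra_simps sum_subtractf)

text \<open>By the binomial theorem one difference in direction \<open>y\<close> turns
  \<open>z ^ e\<close> into \<open>e * y * z ^ (e - 1)\<close> plus lower powers of
  \<open>z\<close>. As many differences as the degree leave only the leading term, and more leave
  nothing.\<close>

lemma fdiff_power:
  fixes ys :: "'a::comm_ring_1 list"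
  shows "(e < length ys \<longrightarrow> fdiff (\<lambda>z. z ^ e) ys z = 0) \<and>
    (e = length ys \<longrightarrow> fdiff (\<lambda>z. z ^ e) ys z = of_nat (fact e) * prod_list ys)"
proof (induction ys arbitrary: e z)
  case (Cons y ys)
  have "(z + y) ^ e - z ^ e = (\<Sum>j<e. (of_nat (e choose j) * y ^ (e - j)) * z ^ j)" for z :: 'a
  proof -
    have "(z + y) ^ e = (\<Sum>j\<le>e. (of_nat (e choose j) * y ^ (e - j)) * z ^ j)"
      unfolding binomial_ring by (rule sum.cong) (auto simp: algebra_simps)
    then show ?thesis by (simp add: sum.lessThan_Suc[symmetric] lessThan_Suc_atMost[symmetric])
  qed
  then have eq: "fdiff (\<lambda>z. z ^ e) (y # ys) z =
      (\<Sum>j<e. (of_nat (e choose j) * y ^ (e - j)) * fdiff (\<lambda>z. z ^ j) ys z)"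
    unfolding fdiff_Cons by (simp add: fdiff_sum)
  show ?case
  proof (intro conjI impI)
    assume "e < length (y # ys)"
    then show "fdiff (\<lambda>z. z ^ e) (y # ys) z = 0"
      unfolding eq using Cons by (intro sum.neutral) auto
  next
    assume e: "e = length (y # ys)"
    have "fdiff (\<lambda>z. z ^ e) (y # ys) z = of_nat (e choose length ys) * y * (of_nat (fact (length ys)) * prod_list ys)"
      unfolding eq using e Cons by simp
    also have "\<dots> = of_nat (fact e) * prod_list (y # ys)"
      using e by (simp add: algebra_simps)
    finally show "fdiff (\<lambda>z. z ^ e) (y # ys) z = of_nat (fact e) * prod_list (y # ys)" .
  qed
qed simp

text \<open>The exponents of \<open>m\<close> become coefficients. Indexing the forms by monomials
  makes their number a number of monomials, and adding a variable to the form is multiplying the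
  monomial by it.\<close>

definition linform :: "monomial \<Rightarrow> 'a::comm_ring_1 mpoly" where
  "linform m = (\<Sum>i\<in>Poly_Mapping.keys m. of_nat (Poly_Mapping.lookup m i) * mpoly_var i)"

lemma linform_eq_sum:
  "finite A \<Longrightarrow> Poly_Mapping.keys m \<subseteq> A \<Longrightarrow>
    linform m = (\<Sum>i\<in>A. of_nat (Poly_Mapping.lookup m i) * mpoly_var i)"
  unfolding linform_def by (rule sum.mono_neutral_left) (auto simp: in_keys_iff)

lemma linform_add_single: "linform (m + Poly_Mapping.single i 1) = linform m + mpoly_var i"
proof -
  let ?A = "insert i (Poly_Mapping.keys m)"
  have "linform (m + Poly_Mapping.single i 1) =
      (\<Sum>j\<in>?A. of_nat (Poly_Mapping.lookup m j) * mpoly_var j + (if j = i then mpoly_var i else 0))"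
    by (subst linform_eq_sum[of ?A])
       (auto simp: keys_add_nat lookup_add lookup_single when_def algebra_simps intro!: sum.cong)
  also have "\<dots> = (\<Sum>j\<in>?A. of_nat (Poly_Mapping.lookup m j) * mpoly_var j) + mpoly_var i"
    unfolding sum.distrib by simp
  also have "(\<Sum>j\<in>?A. of_nat (Poly_Mapping.lookup m j) * mpoly_var j) = linform m"
    by (rule linform_eq_sum[symmetric]) auto
  finally show ?thesis .
qed

lemma linform_supp: "m \<in> over V \<Longrightarrow> linform m \<in> supp (mons V 1)"
  unfolding linform_def mpoly_const_of_nat[symmetric]
  by (intro supp_sum supp_scale mpoly_var_supp) (auto simp: over_def)

text \<open>Each difference either adds its variable to the form or leaves it alone, so all
  evaluation points are forms \<open>linform b\<close> with \<open>mdeg b\<close> at most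
  \<open>mdeg c + length is\<close>.\<close>

lemma fdiff_linform_rspan:
  assumes "finite V"
  shows "set is \<subseteq> V \<Longrightarrow> c \<in> over V \<Longrightarrow> mdeg c + length is \<le> e \<Longrightarrow>
    fdiff (\<lambda>z. z ^ e) (map mpoly_var is) (linform c :: 'a::comm_ring_1 mpoly) \<in> rspan (range mpoly_const) ((\<lambda>b. linform b ^ e) ` mons_le V e)"
proof (induction "is" arbitrary: c)
  case Nil
  then show ?case
    using assms finite_mons_le by (intro rspan_base[OF closed_ring_consts]) (auto simp: mons_defs)
next
  case (Cons i "is")
  let ?S = "rspan (range mpoly_const) ((\<lambda>b. linform b ^ e) ` mons_le V e)"
  let ?f = "\<lambda>c. fdiff (\<lambda>z. z ^ e) (map mpoly_var is) (linform c :: 'a mpoly)"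
  have "?f (c + Poly_Mapping.single i 1) \<in> ?S" "?f c \<in> ?S"
    using Cons.prems by (auto intro!: Cons.IH[unfolded One_nat_def] simp: over_def keys_add_nat mdeg_add)
  then have "?f (c + Poly_Mapping.single i 1) + mpoly_const (- 1) * ?f c \<in> ?S"
    by (intro rspan_add rspan_scale closed_ring_consts) auto
  then show ?case
    by (simp add: linform_add_single[unfolded One_nat_def] mpoly_const_uminus)
qed

lemma monomial_prod_vars:
  "m \<in> mons V e \<Longrightarrow> \<exists>is. length is = e \<and> set is \<subseteq> V \<and>
    Poly_Mapping.single m (1::'a::comm_ring_1) = prod_list (map mpoly_var is)"
proof (induction e arbitrary: m)
  case 0
  then show ?case by (auto simp: mons_defs mdeg_eq_0_iff)
next
  case (Suc e)
  then obtain m' i where m': "m' \<in> mons V e" "i \<in> V" "m = m' + Poly_Mapping.single i 1"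
    using mons_Suc_split by blast
  obtain "is" where vars: "length is = e" "set is \<subseteq> V"
      "Poly_Mapping.single m' (1::'a) = prod_list (map mpoly_var is)"
    using Suc.IH[OF m'(1)] by blast
  have "Poly_Mapping.single m (1::'a) = mpoly_var i * Poly_Mapping.single m' 1"
    by (simp add: m' mpoly_var_def mult_single add.commute)
  then show ?case
    using m' vars by (intro exI[of _ "i # is"]) simp
qed

text \<open>Polarization: a monomial is a product of \<open>e\<close> variables, the
  \<open>e\<close>-fold difference of the \<open>e\<close>-th power in these directions is
  \<open>fact e\<close> times it, and characteristic 0 allows division by
  \<open>fact e\<close>.\<close>

lemma homogeneous_rspan_powers:
  fixes p :: "'a::field_char_0 mpoly"
  assumes V: "finite V" and p: "p \<in> supp (mons V e)"
  shows "p \<in> rspan (range mpoly_const) ((\<lambda>b. linform b ^ e) ` mons_le V e)" (is "_ \<in> ?S")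
proof -
  have "Poly_Mapping.single m a \<in> ?S" if m: "m \<in> mons V e" for m and a :: 'a
  proof -
    obtain "is" where vars: "length is = e" "set is \<subseteq> V"
        "Poly_Mapping.single m (1::'a) = prod_list (map mpoly_var is)"
      using monomial_prod_vars[OF m] by blast
    have "fdiff (\<lambda>z. z ^ e) (map mpoly_var is) (linform 0) \<in> ?S"
      by (rule fdiff_linform_rspan) (use V vars in auto)
    moreover have "fdiff (\<lambda>z. z ^ e) (map mpoly_var is) (linform 0 :: 'a mpoly) = of_nat (fact e) * Poly_Mapping.single m 1"
      using fdiff_power[of e "map mpoly_var is" "linform 0 :: 'a mpoly"] vars by simp
    ultimately have "of_nat (fact e) * Poly_Mapping.single m 1 \<in> ?S"
      by simp
    then have "mpoly_const (a / of_nat (fact e)) * (of_nat (fact e) * Poly_Mapping.single m 1) \<in> ?S"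
      by (rule rspan_scale[OF closed_ring_consts rangeI])
    moreover have "mpoly_const (a / of_nat (fact e)) * (of_nat (fact e) * Poly_Mapping.single m 1) = Poly_Mapping.single m a"
      unfolding mpoly_const_of_nat[symmetric] mpoly_const_def mult_single
      by (simp add: fact_nonzero)
    ultimately show ?thesis by simp
  qed
  then have "(\<Sum>m\<in>Poly_Mapping.keys p. Poly_Mapping.single m (Poly_Mapping.lookup p m)) \<in> ?S"
    using p by (intro rspan_sum closed_ring_consts) (auto simp: supp_def)
  then show ?thesis
    using mpoly_eq_sum_single[of p] by simp
qed

section \<open>Change of coefficients\<close>

text \<open>Used for three embeddings: complex constants into polynomials in epsilon, these into
  their fraction field, and complex constants into \<open>complex poly mpoly\<close>. The last one
  allows evaluating univariate complex polynomials at elements of that ring.\<close>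

locale coeff_hom =
  fixes h :: "'a::comm_ring_1 \<Rightarrow> 'b::comm_ring_1"
  assumes h_add: "h (a + b) = h a + h b"
    and h_mult: "h (a * b) = h a * h b"
    and h_1: "h 1 = 1"
begin

lemma h_0: "h 0 = 0"
  using h_add[of 0 0] by simp

lemma lookup_map_h: "Poly_Mapping.lookup (Poly_Mapping.map h p) m = h (Poly_Mapping.lookup p m)"
  by (simp add: Poly_Mapping.map.rep_eq when_def h_0)

lemma map_add: "Poly_Mapping.map h (p + q) = Poly_Mapping.map h p + Poly_Mapping.map h q"
  by (rule poly_mapping_eqI) (simp add: lookup_map_h lookup_add h_add)

lemma map_0: "Poly_Mapping.map h 0 = 0"
  by (rule poly_mapping_eqI) (simp add: lookup_map_h h_0)

lemma map_single: "Poly_Mapping.map h (Poly_Mapping.single m a) = Poly_Mapping.single m (h a)"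
  by (rule poly_mapping_eqI) (simp add: lookup_map_h lookup_single when_def h_0)

lemma map_const: "Poly_Mapping.map h (mpoly_const a) = mpoly_const (h a)"
  by (simp add: mpoly_const_def map_single)

lemma map_mult:
  fixes p q :: "'a mpoly"
  shows "Poly_Mapping.map h (p * q) = Poly_Mapping.map h p * Poly_Mapping.map h q"
proof (induction p rule: mpoly_induct)
  case (single a x)
  show ?case
    by (induction q rule: mpoly_induct)
       (auto simp: map_add map_0 map_single mult_single h_mult algebra_simps)
qed (auto simp: map_add map_0 algebra_simps)

lemma map_1: "Poly_Mapping.map h (1 :: 'a mpoly) = 1"
  using map_const[of 1] by (simp add: h_1)

lemma map_power: "Poly_Mapping.map h ((p :: 'a mpoly) ^ k) = Poly_Mapping.map h p ^ k"
  by (induction k) (auto simp: map_1 map_mult)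

lemma map_prod_list:
  "Poly_Mapping.map h (prod_list (ps :: 'a mpoly list)) = prod_list (map (Poly_Mapping.map h) ps)"
  by (induction ps) (auto simp: map_1 map_mult)

lemma map_supp: "p \<in> supp S \<Longrightarrow> Poly_Mapping.map h p \<in> supp S"
  by (force simp: supp_def in_keys_iff lookup_map_h h_0)

lemma poly_map_poly_mult:
  "poly (map_poly h (p * q)) y = poly (map_poly h p) y * poly (map_poly h q) y"
proof -
  have add: "map_poly h (p + q) = map_poly h p + map_poly h q" for p q
    by (rule poly_eqI) (simp add: coeff_map_poly h_0 h_add)
  show ?thesis
    by (induction p)
       (auto simp: mult_pCons_left add map_poly_smult map_poly_pCons h_0 h_mult algebra_simps)
qed

text \<open>Carries a factorization of a univariate polynomial over to its value at
  \<open>y\<close>.\<close>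

lemma poly_map_poly_prod_list:
  "poly (map_poly h (prod_list ps)) y = (\<Prod>p\<leftarrow>ps. poly (map_poly h p) y)"
  by (induction ps) (auto simp: poly_map_poly_mult h_0 h_1)

end

interpretation embed: coeff_hom "\<lambda>a :: complex. [:a:]"
  by unfold_locales auto

interpretation frac: coeff_hom "to_fract :: complex poly \<Rightarrow> _"
  by unfold_locales auto

interpretation embed_const: coeff_hom "\<lambda>a :: complex. mpoly_const [:a:] :: complex poly mpoly"
proof unfold_locales
  show "mpoly_const [:a + b:] = mpoly_const [:a:] + (mpoly_const [:b:] :: complex poly mpoly)" for a b :: complex
    by (simp flip: mpoly_const_add)
  show "mpoly_const [:a * b:] = mpoly_const [:a:] * (mpoly_const [:b:] :: complex poly mpoly)" for a b :: complex
    by (simp add: mult.commute flip: mpoly_const_mult)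
  show "mpoly_const [:1:] = (1 :: complex poly mpoly)"
    by (simp flip: one_pCons)
qed

abbreviation embed :: "complex mpoly \<Rightarrow> complex poly mpoly" where
  "embed \<equiv> Poly_Mapping.map (\<lambda>a. [:a:])"

text \<open>Epsilon as an element of the ring of \<open>Q\<close>. Computations stay in this ring
  until the division by a power of epsilon in \<open>approx_homogeneous\<close>.\<close>

definition eps_poly :: "complex poly mpoly" where
  "eps_poly = mpoly_const [:0, 1:]"

lemma lift_eps_eps_poly: "lift_eps eps_poly = mpoly_const eps"
  by (simp add: lift_eps_def eps_poly_def frac.map_const eps_def)

lemma lift_const_eq: "lift_const p = lift_eps (embed p)"
  by (rule poly_mapping_eqI)
     (simp add: lift_const_def lift_eps_def Poly_Mapping.map.rep_eq when_def)

lemma eps_poly_mult_supp: "p \<in> supp S \<Longrightarrow> eps_poly ^ k * p \<in> supp S"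
  by (simp add: eps_poly_def supp_scale flip: mpoly_const_power)

section \<open>Approximation by two products of affine forms\<close>

text \<open>Roots are split off one at a time. Constants count as factors of degree at most 1, which
  absorbs leading coefficients; \<open>1 \<le> n\<close> leaves room for the factor when
  \<open>p\<close> is constant.\<close>

lemma complex_poly_split:
  fixes p :: "complex poly"
  shows "degree p \<le> n \<Longrightarrow> 1 \<le> n \<Longrightarrow> \<exists>ps. length ps \<le> n \<and> (\<forall>q\<in>set ps. degree q \<le> 1) \<and> p = prod_list ps"
proof (induction n arbitrary: p)
  case (Suc n)
  show ?case
  proof (cases "degree p \<le> 1")
    case True
    then show ?thesis by (intro exI[of _ "[p]"]) auto
  next
    case False
    then have "\<not> constant (poly p)" by (simp add: constant_degree)
    then obtain z where "poly p z = 0"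
      using fundamental_theorem_of_algebra by blast
    then obtain q where q: "p = [:- z, 1:] * q"
      by (metis dvdE poly_eq_0_iff_dvd)
    have "q \<noteq> 0" using q False by auto
    then have "degree p = Suc (degree q)" unfolding q by (subst degree_mult_eq) auto
    then obtain ps where ps: "length ps \<le> n" "\<forall>q\<in>set ps. degree q \<le> 1" "q = prod_list ps"
      using Suc.IH[of q] Suc.prems False by auto
    show ?thesis
      using ps q by (intro exI[of _ "[:- z, 1:] # ps"]) auto
  qed
qed simp

text \<open>The univariate polynomial \<open>1 + monom c e\<close> splits over the complex numbers
  into at most \<open>e\<close> factors of degree at most 1. Evaluated at epsilon times
  \<open>L\<close>, these become affine forms.\<close>

lemma one_plus_power_split:
  assumes e: "e \<ge> 1" and L: "L \<in> supp (mons V 1)"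
  shows "\<exists>gs. length gs \<le> e \<and> set gs \<subseteq> supp (mons_le V 1) \<and>
    prod_list gs = 1 + eps_poly ^ e * embed (mpoly_const c * L ^ e)"
proof -
  define p :: "complex poly" where "p = 1 + monom c e"
  define y where "y = eps_poly * embed L"
  define ev where "ev = (\<lambda>q. poly (map_poly (\<lambda>a. mpoly_const [:a:]) q) y)"
  have "degree p \<le> e"
    unfolding p_def by (intro degree_add_le) (auto simp: degree_monom_le)
  then obtain ps where ps: "length ps \<le> e" "\<forall>q\<in>set ps. degree q \<le> 1" "p = prod_list ps"
    using complex_poly_split e by blast
  have "map_poly (\<lambda>a. mpoly_const [:a:] :: complex poly mpoly) p = 1 + monom (mpoly_const [:c:]) e"
    by (rule poly_eqI) (auto simp: p_def coeff_map_poly embed_const.h_add embed_const.h_0 embed_const.h_1)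
  then have "ev p = 1 + mpoly_const [:c:] * y ^ e"
    by (simp add: ev_def poly_monom)
  also have "\<dots> = 1 + eps_poly ^ e * embed (mpoly_const c * L ^ e)"
    by (simp add: y_def embed.map_mult embed.map_const embed.map_power power_mult_distrib algebra_simps)
  finally have eq: "prod_list (map ev ps) = 1 + eps_poly ^ e * embed (mpoly_const c * L ^ e)"
    using ps(3) embed_const.poly_map_poly_prod_list[of ps y] by (simp add: ev_def)
  have y: "y \<in> supp (mons_le V 1)"
  proof -
    have "embed L \<in> supp (mons V 1)" by (rule embed.map_supp[OF L])
    then have "y \<in> supp (mons V 1)" unfolding y_def using eps_poly_mult_supp[of _ _ 1] by simp
    then show ?thesis by (rule mons_imp_mons_le) simp
  qed
  have "ev q \<in> supp (mons_le V 1)" if q: "q \<in> set ps" for q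
  proof -
    have "q = [:coeff q 0, coeff q 1:]"
      using ps(2) q by (intro poly_eqI) (auto simp: coeff_pCons coeff_eq_0 split: nat.split)
    then have "ev q = mpoly_const [:coeff q 0:] + mpoly_const [:coeff q 1:] * y"
      by (subst (asm) (1) eq_commute, subst ev_def) 
         (metis (no_types, lifting) embed_const.h_0 map_poly_pCons map_poly_0 mult.commute poly_0 poly_pCons mult_zero_right add_0_right)
    then show ?thesis
      using y by (auto intro!: supp_add supp_scale mpoly_const_supp)
  qed
  then show ?thesis
    using ps(1) eq by (intro exI[of _ "map ev ps"]) auto
qed

text \<open>Kumar's trick: the cross terms of the product below have degree at least \<open>2e\<close>.\<close>

lemma prod_one_plus_powers:
  assumes "e \<ge> 1" "finite G"
    and "\<And>g. g \<in> G \<Longrightarrow> \<exists>L\<in>supp (mons V 1). g = L ^ e"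
    and "\<And>g. g \<in> G \<Longrightarrow> Y g \<in> range mpoly_const"
  shows "\<exists>gs Q. length gs \<le> e * card G \<and> set gs \<subseteq> supp (mons_le V 1) \<and>
    Q \<in> supp (mons_ge V (Suc e)) \<and>
    prod_list gs = 1 + eps_poly ^ e * embed (\<Sum>g\<in>G. Y g * g) + eps_poly ^ Suc e * Q"
  using assms(2,3,4)
proof (induction G)
  case empty
  show ?case
    by (intro exI[of _ "[]"] exI[of _ 0]) (simp add: embed.map_0)
next
  case (insert x G)
  define S where "S = (\<Sum>g\<in>G. Y g * g)"
  obtain gs Q where gs: "length gs \<le> e * card G" "set gs \<subseteq> supp (mons_le V 1)"
      "Q \<in> supp (mons_ge V (Suc e))" "prod_list gs = 1 + eps_poly ^ e * embed S + eps_poly ^ Suc e * Q"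
    using insert.IH insert.prems unfolding S_def by auto
  obtain L c where L: "L \<in> supp (mons V 1)" "x = L ^ e" "Y x = mpoly_const c"
    using insert.prems by blast
  obtain hs where hs: "length hs \<le> e" "set hs \<subseteq> supp (mons_le V 1)"
      "prod_list hs = 1 + eps_poly ^ e * embed (mpoly_const c * L ^ e)"
    using one_plus_power_split[OF \<open>e \<ge> 1\<close> L(1)] by blast
  define M where "M = embed (mpoly_const c * L ^ e)"
  \<comment> \<open>In the product of \<open>prod_list hs\<close> and \<open>prod_list gs\<close>
    the new terms are epsilon to the \<open>2 * e\<close> times \<open>embed S * M\<close> and
    epsilon to the \<open>2 * e + 1\<close> times \<open>Q * M\<close>. Taking out epsilon to the
    \<open>e + 1\<close> leaves the exponents \<open>e - 1\<close> and \<open>e\<close>.\<close>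
  define Q' where "Q' = Q + eps_poly ^ e * (Q * M) + eps_poly ^ (e - 1) * (embed S * M)"
  have powers: "L' ^ e \<in> supp (mons_ge V e)" if "L' \<in> supp (mons V 1)" for L' :: "complex mpoly"
    using power_mons[OF that, of e] by (rule mons_imp_mons_ge) simp
  have "M \<in> supp (mons_ge V e)"
    unfolding M_def by (intro embed.map_supp supp_scale powers L)
  moreover have "embed S \<in> supp (mons_ge V e)"
    unfolding S_def
  proof (intro embed.map_supp supp_sum)
    fix g assume "g \<in> G"
    then obtain L' a where "L' \<in> supp (mons V 1)" "g = L' ^ e" "Y g = mpoly_const a"
      using insert.prems by blast
    then show "Y g * g \<in> supp (mons_ge V e)"
      using supp_scale[OF powers] by metis
  qed
  ultimately have "Q' \<in> supp (mons_ge V (Suc e))"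
    unfolding Q'_def using gs(3) \<open>e \<ge> 1\<close>
    by (intro supp_add eps_poly_mult_supp mons_ge_mult[of _ V "Suc e" _ e] mons_ge_mult[of _ V e _ e]) auto
  moreover have "prod_list (hs @ gs) = 1 + eps_poly ^ e * embed (\<Sum>g\<in>insert x G. Y g * g) + eps_poly ^ Suc e * Q'"
  proof -
    have "eps_poly ^ e = eps_poly * eps_poly ^ (e - 1)"
      using \<open>e \<ge> 1\<close> by (cases e) auto
    then have "eps_poly ^ e * eps_poly ^ e = eps_poly ^ Suc e * eps_poly ^ (e - 1)"
      by (simp add: algebra_simps)
    then have "eps_poly ^ e * embed S * (eps_poly ^ e * M) = eps_poly ^ Suc e * (eps_poly ^ (e - 1) * (embed S * M))"
      by (simp add: algebra_simps) (metis mult.assoc mult.left_commute)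
    moreover have "embed (\<Sum>g\<in>insert x G. Y g * g) = embed S + M"
      using insert.hyps by (simp add: S_def M_def embed.map_add L(3) flip: L(2))
    ultimately show ?thesis
      by (simp add: gs(4) hs(3) M_def[symmetric] Q'_def algebra_simps)
  qed
  ultimately show ?case
    using gs(1,2) hs(1,2) insert.hyps
    by (intro exI[of _ "hs @ gs"] exI[of _ Q']) auto
qed

text \<open>An invariant that survives sums and products. \<open>M\<close> bounds the top fan-in and
  \<open>F\<close> the formal degree; as \<open>Q\<close> has no denominators, multiplying
  approximations produces no negative powers of epsilon in the error.\<close>

definition approx :: "nat set \<Rightarrow> nat \<Rightarrow> nat \<Rightarrow> nat \<Rightarrow> complex mpoly \<Rightarrow> bool" where
  "approx V d M F p \<longleftrightarrow> (\<exists>C Q.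
     (\<forall>g\<in>set C. set g \<subseteq> supp (mons_le V 1) \<and> length g \<le> F) \<and> length C \<le> M \<and>
     Q \<in> supp (mons_ge V (Suc d)) \<and> depth3_poly C = lift_eps (embed p + eps_poly * Q))"

section \<open>Sums and products of approximations\<close>

lemma approx_0: "approx V d M F 0"
  unfolding approx_def
  by (intro exI[of _ "[]"] exI[of _ 0]) (auto simp: depth3_poly_def embed.map_0 lift_eps_def frac.map_0)

lemma approx_mono: "approx V d M F p \<Longrightarrow> M \<le> M' \<Longrightarrow> F \<le> F' \<Longrightarrow> approx V d M' F' p"
  unfolding approx_def by (meson order_trans)

lemma approx_add:
  assumes "approx V d M F p" "approx V d M' F q"
  shows "approx V d (M + M') F (p + q)"
proof -
  obtain C Q where C: "\<forall>g\<in>set C. set g \<subseteq> supp (mons_le V 1) \<and> length g \<le> F" "length C \<le> M"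
     "Q \<in> supp (mons_ge V (Suc d))" "depth3_poly C = lift_eps (embed p + eps_poly * Q)"
    using assms(1) unfolding approx_def by blast
  obtain C' Q' where C': "\<forall>g\<in>set C'. set g \<subseteq> supp (mons_le V 1) \<and> length g \<le> F" "length C' \<le> M'"
     "Q' \<in> supp (mons_ge V (Suc d))" "depth3_poly C' = lift_eps (embed q + eps_poly * Q')"
    using assms(2) unfolding approx_def by blast
  have "depth3_poly (C @ C') = lift_eps (embed (p + q) + eps_poly * (Q + Q'))"
    using C(4) C'(4)
    by (simp add: depth3_poly_def lift_eps_def embed.map_add flip: frac.map_add) (simp add: algebra_simps)
  then show ?thesis
    unfolding approx_def using C C'
    by (intro exI[of _ "C @ C'"] exI[of _ "Q + Q'"]) (auto intro: supp_add)
qed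

lemma depth3_poly_product:
  "depth3_poly (concat (map (\<lambda>g. map ((@) g) C') C)) = depth3_poly C * depth3_poly C'"
proof -
  have "sum_list (map prod_list (map ((@) g) C')) = prod_list g * depth3_poly C'" for g
    by (induction C') (auto simp: depth3_poly_def algebra_simps)
  then show ?thesis
    by (induction C) (auto simp: depth3_poly_def algebra_simps)
qed

text \<open>Distributing multiplies fan-ins and adds formal degrees. As \<open>p\<close> and
  \<open>q\<close> are homogeneous of degrees \<open>i\<close> and \<open>j\<close>, each error term
  pairs a factor above its degree with one at or above its degree, and so exceeds
  \<open>i + j\<close>.\<close>

lemma approx_mult:
  assumes "approx V i M F p" "approx V j M' F' q" "p \<in> supp (mons V i)" "q \<in> supp (mons V j)"
  shows "approx V (i + j) (M * M') (F + F') (p * q)"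
proof -
  obtain C Q where C: "\<forall>g\<in>set C. set g \<subseteq> supp (mons_le V 1) \<and> length g \<le> F" "length C \<le> M"
     "Q \<in> supp (mons_ge V (Suc i))" "depth3_poly C = lift_eps (embed p + eps_poly * Q)"
    using assms(1) unfolding approx_def by blast
  obtain C' Q' where C': "\<forall>g\<in>set C'. set g \<subseteq> supp (mons_le V 1) \<and> length g \<le> F'" "length C' \<le> M'"
     "Q' \<in> supp (mons_ge V (Suc j))" "depth3_poly C' = lift_eps (embed q + eps_poly * Q')"
    using assms(2) unfolding approx_def by blast
  let ?C = "concat (map (\<lambda>g. map ((@) g) C') C)"
  define Q'' where "Q'' = embed p * Q' + Q * embed q + eps_poly ^ 1 * (Q * Q')"
  have ge: "embed r \<in> supp (mons_ge V k)" if "r \<in> supp (mons V k)" for r k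
    using embed.map_supp[OF that] by (rule mons_imp_mons_ge) simp
  have "Q'' \<in> supp (mons_ge V (Suc (i + j)))"
    unfolding Q''_def
    by (intro supp_add eps_poly_mult_supp mons_ge_mult[OF ge[OF assms(3)] C'(3)]
        mons_ge_mult[OF C(3) ge[OF assms(4)]] mons_ge_mult[OF C(3) C'(3)]) auto
  moreover have "depth3_poly ?C = lift_eps (embed (p * q) + eps_poly * Q'')"
    unfolding depth3_poly_product C(4) C'(4) lift_eps_def frac.map_mult[symmetric] Q''_def embed.map_mult
    by (simp add: algebra_simps)
  moreover have "length ?C = length C * length C'"
    by (induction C) auto
  then have "length ?C \<le> M * M'"
    using C(2) C'(2) by (simp add: mult_le_mono)
  ultimately show ?thesis
    unfolding approx_def using C(1) C'(1)
    by (intro exI[of _ ?C] exI[of _ Q'']) (auto intro: add_le_mono)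
qed

lemma approx_const: "approx V 0 1 1 (mpoly_const a)"
  unfolding approx_def
  by (intro exI[of _ "[[lift_eps (embed (mpoly_const a))]]"] exI[of _ 0])
     (auto simp: depth3_poly_def embed.map_const lift_eps_def frac.map_const intro: mpoly_const_supp)

text \<open>The two gates are the product of affine forms and the constant that is subtracted. The
  \<open>1 +\<close> in the formal degree is the scalar factor \<open>inverse (eps ^ e)\<close> of
  the first gate.\<close>

lemma approx_homogeneous:
  assumes V: "finite V" and e: "e \<ge> 1" and p: "p \<in> supp (mons V e)"
  shows "approx V e 2 (1 + e * card (mons_le V e)) p"
proof -
  let ?G = "(\<lambda>b. linform b ^ e) ` mons_le V e :: complex mpoly set"
  obtain Y where Y: "\<forall>g\<in>?G. Y g \<in> range mpoly_const" "p = (\<Sum>g\<in>?G. Y g * g)"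
    using homogeneous_rspan_powers[OF V p] unfolding rspan_def by blast
  have "\<exists>gs Q. length gs \<le> e * card ?G \<and> set gs \<subseteq> supp (mons_le V 1) \<and>
      Q \<in> supp (mons_ge V (Suc e)) \<and> prod_list gs = 1 + eps_poly ^ e * embed (\<Sum>g\<in>?G. Y g * g) + eps_poly ^ Suc e * Q"
  proof (rule prod_one_plus_powers[OF e])
    show "\<exists>L\<in>supp (mons V 1). g = L ^ e" if "g \<in> ?G" for g
      using that by (auto intro!: bexI linform_supp[unfolded One_nat_def] simp: mons_le_def)
  qed (use V Y finite_mons_le in auto)
  then obtain gs Q where gs: "length gs \<le> e * card ?G" "set gs \<subseteq> supp (mons_le V 1)"
      "Q \<in> supp (mons_ge V (Suc e))" "prod_list gs = 1 + eps_poly ^ e * embed p + eps_poly ^ Suc e * Q"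
    unfolding Y(2)[symmetric] by blast
  define a where "a = inverse (eps ^ e)"
  define C where "C = [mpoly_const a # map lift_eps gs, [mpoly_const (- a)]]"
  have "eps \<noteq> 0" by (simp add: eps_def)
  then have "mpoly_const a * mpoly_const eps ^ e = 1"
    unfolding mpoly_const_power[symmetric] mpoly_const_mult[symmetric] by (simp add: a_def)
  then have aE: "mpoly_const a * lift_eps (eps_poly ^ e) = 1"
    by (simp add: lift_eps_def frac.map_power flip: lift_eps_eps_poly)
  have "depth3_poly C = mpoly_const a * lift_eps (prod_list gs) - mpoly_const a"
    by (simp add: C_def depth3_poly_def mpoly_const_uminus lift_eps_def[abs_def] frac.map_prod_list)
  also have "lift_eps (prod_list gs) = 1 + lift_eps (eps_poly ^ e) * lift_eps (embed p + eps_poly * Q)"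
    unfolding gs(4) lift_eps_def frac.map_mult[symmetric] frac.map_1[symmetric] frac.map_add[symmetric]
    by (simp add: algebra_simps)
  also have "mpoly_const a * \<dots> - mpoly_const a = mpoly_const a * lift_eps (eps_poly ^ e) * lift_eps (embed p + eps_poly * Q)"
    by (simp add: algebra_simps)
  finally have "depth3_poly C = lift_eps (embed p + eps_poly * Q)"
    by (simp add: aE)
  moreover have "card ?G \<le> card (mons_le V e)"
    using V by (intro card_image_le finite_mons_le)
  then have "length gs \<le> e * card (mons_le V e)"
    using gs(1) by (meson le_trans mult_le_mono2)
  moreover have "lift_eps g \<in> supp (mons_le V 1)" if "g \<in> set gs" for g
    using gs(2) that unfolding lift_eps_def by (intro frac.map_supp) auto
  ultimately show ?thesis
    unfolding approx_def using gs(3)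
    by (intro exI[of _ C] exI[of _ Q]) (auto simp: C_def intro: mpoly_const_supp)
qed

text \<open>Adds degree 0, where the approximation is exact, and makes the bound uniform in
  \<open>e \<le> K\<close>, as the recursion in \<open>approx_hc\<close> needs.\<close>

lemma approx_form:
  assumes "finite V" "p \<in> supp (mons V e)" "e \<le> K"
  shows "approx V e 2 (1 + K * card (mons_le V K)) p"
proof (cases "e = 0")
  case True
  then obtain a where "p = mpoly_const a" using assms(2) mons_0_const by blast
  then show ?thesis using True approx_mono[OF approx_const[of V a]] by simp
next
  case False
  have "card (mons_le V e) \<le> card (mons_le V K)"
    using assms by (intro card_mono finite_mons_le) (auto simp: mons_defs)
  then show ?thesis
    using approx_homogeneous[of V e p] assms False
    by (auto elim!: approx_mono intro!: mult_le_mono)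
qed

text \<open>
  The coefficient of a monomial is absorbed by its first factor: as a separate factor it
  would raise the formal degree to \<open>d + 1\<close>.
\<close>

lemma approx_monomials:
  assumes V: "finite V" and d: "d \<ge> 1" and p: "p \<in> supp (mons V d)"
  shows "approx V d (card (mons V d)) d p"
proof -
  have mon: "approx V d 1 d (Poly_Mapping.single m a)" if m: "m \<in> mons V d" for m a
  proof -
    obtain "is" where vars: "length is = d" "set is \<subseteq> V"
        "Poly_Mapping.single m (1::complex) = prod_list (map mpoly_var is)"
      using monomial_prod_vars[OF m] by blast
    then obtain i js where js: "is = i # js" using d by (cases "is") auto
    let ?g = "(mpoly_const a * mpoly_var i) # map mpoly_var js"
    have var: "mpoly_var j \<in> supp (mons_le V 1)" if "j \<in> V" for j
      using mpoly_var_supp[OF that] by (rule mons_imp_mons_le) simp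
    have "Poly_Mapping.single m a = mpoly_const a * Poly_Mapping.single m 1"
      by (simp add: mpoly_const_def mult_single)
    also have "\<dots> = prod_list ?g"
      unfolding vars(3) js by (simp add: mult.assoc)
    finally have "lift_eps (embed (Poly_Mapping.single m a)) = prod_list (map (\<lambda>l. lift_eps (embed l)) ?g)"
      by (simp only: embed.map_prod_list lift_eps_def frac.map_prod_list map_map o_def)
    moreover have "set ?g \<subseteq> supp (mons_le V 1)"
      using vars(2) js by (auto intro!: supp_scale var[unfolded One_nat_def])
    then have "set (map (\<lambda>l. lift_eps (embed l)) ?g) \<subseteq> supp (mons_le V 1)"
      unfolding lift_eps_def by (auto intro!: frac.map_supp embed.map_supp)
    ultimately show ?thesis
      unfolding approx_def using vars(1) js
      by (intro exI[of _ "[map (\<lambda>l. lift_eps (embed l)) ?g]"] exI[of _ 0])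
         (auto simp: depth3_poly_def)
  qed
  have "approx V d (card A) d (\<Sum>m\<in>A. Poly_Mapping.single m (Poly_Mapping.lookup p m))"
    if "finite A" "A \<subseteq> mons V d" for A
    using that
  proof induction
    case (insert m A)
    then show ?case
      using approx_add[OF mon[of m "Poly_Mapping.lookup p m"]] by simp
  qed (simp add: approx_0)
  from this[of "Poly_Mapping.keys p"] have "approx V d (card (Poly_Mapping.keys p)) d p"
    using p mpoly_eq_sum_single[of p] by (simp add: supp_def)
  moreover have "card (Poly_Mapping.keys p) \<le> card (mons V d)"
    using p V by (intro card_mono finite_mons) (auto simp: supp_def)
  ultimately show ?thesis
    by (rule approx_mono) simp
qed

section \<open>Homogeneous components of the gates of a circuit\<close>

text \<open>The open interval excludes factors of degree 0, so both factors have degree strictly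
  below \<open>i\<close> and induction on the degree is possible.\<close>

definition splittings :: "'a::comm_ring_1 mpoly set \<Rightarrow> nat \<Rightarrow> 'a mpoly set" where
  "splittings F i = (\<lambda>(a, b, j). hc j a * hc (i - j) b) ` (F \<times> F \<times> {0<..<i})"

text \<open>This replaces the homogenized circuit: the members of \<open>F\<close> are gates, and
  \<open>card F\<close> plays the role of the size. Components of degree 0 and 1 are the
  unconstrained base.\<close>

definition splits :: "'a::comm_ring_1 mpoly set \<Rightarrow> bool" where
  "splits F \<longleftrightarrow> finite F \<and> (\<forall>f\<in>F. \<forall>i\<ge>2. hc i f \<in> rspan (range mpoly_const) (splittings F i))"

lemma finite_splittings: "finite F \<Longrightarrow> finite (splittings F i)"
  by (auto simp: splittings_def)

lemma splitsD: "splits F \<Longrightarrow> f \<in> F \<Longrightarrow> i \<ge> 2 \<Longrightarrow> hc i f \<in> rspan (range mpoly_const) (splittings F i)"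
  by (auto simp: splits_def)

lemma splits_insert:
  assumes "splits F" "\<And>i. i \<ge> 2 \<Longrightarrow> hc i f \<in> rspan (range mpoly_const) (splittings F i)"
  shows "splits (insert f F)"
proof -
  have "hc i g \<in> rspan (range mpoly_const) (splittings (insert f F) i)" if "g \<in> insert f F" "i \<ge> 2" for g i
  proof (rule rspan_mono[OF closed_ring_consts])
    show "finite (splittings (insert f F) i)"
      using assms(1) by (intro finite_splittings) (auto simp: splits_def)
    show "splittings F i \<subseteq> splittings (insert f F) i"
      unfolding splittings_def by (intro image_mono) auto
    show "hc i g \<in> rspan (range mpoly_const) (splittings F i)"
      using that assms by (auto simp: splits_def)
  qed
  then show ?thesis
    using assms(1) by (auto simp: splits_def)
qed

lemma splits_leaf:
  assumes "splits F" "f \<in> supp (mons_le V 1)"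
  shows "splits (insert f F)"
proof (rule splits_insert[OF assms(1)])
  fix i :: nat assume "i \<ge> 2"
  then have "hc i f = 0"
    using assms(2)
    by (intro poly_mapping_eqI) (force simp: lookup_hc when_def supp_def mons_defs in_keys_iff)
  then show "hc i f \<in> rspan (range mpoly_const) (splittings F i)"
    by (simp add: rspan_0 closed_ring_consts)
qed

lemma splits_sum:
  assumes "splits F" "\<And>x. x \<in> A \<Longrightarrow> u x \<in> F"
  shows "splits (insert (sum u A) F)"
  using assms by (intro splits_insert) (auto simp: hc_sum intro!: rspan_sum closed_ring_consts splitsD)

text \<open>In the convolution for \<open>hc i (g * h)\<close> the inner terms are splittings. The
  two end terms are a constant times \<open>hc i h\<close> or \<open>hc i g\<close>, which are
  combinations of splittings already.\<close>

lemma splits_mult: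
  assumes F: "splits F" "F \<subseteq> supp (over V)" and gh: "g \<in> F" "h \<in> F"
  shows "splits (insert (g * h) F)"
proof (rule splits_insert[OF F(1)])
  fix i :: nat assume i: "i \<ge> 2"
  have "hc j g * hc (i - j) h \<in> rspan (range mpoly_const) (splittings F i)" if "j \<le> i" for j
  proof -
    have const: "hc 0 f \<in> range mpoly_const" if "f \<in> F" for f
    proof -
      have "f \<in> supp (over V)" using that F(2) by blast
      then show ?thesis using mons_0_const[OF hc_supp] by blast
    qed
    have "j = 0 \<or> j = i \<or> j \<in> {0<..<i}"
      using that by auto
    then consider "j = 0" | "j = i" | "j \<in> {0<..<i}"
      by blast
    then show ?thesis
    proof cases
      case 1
      then show ?thesis
        using splitsD[OF F(1) gh(2) i] const[OF gh(1)] by (auto intro: rspan_scale[OF closed_ring_consts])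
    next
      case 2
      then show ?thesis
        using rspan_scale[OF closed_ring_consts const[OF gh(2)] splitsD[OF F(1) gh(1) i]] by (simp add: mult.commute)
    next
      case 3
      then have "hc j g * hc (i - j) h \<in> splittings F i"
        unfolding splittings_def using gh by (intro image_eqI[of _ _ "(g, h, j)"]) auto
      then show ?thesis
        using F(1) by (intro rspan_base closed_ring_consts finite_splittings) (auto simp: splits_def)
    qed
  qed
  then show "hc i (g * h) \<in> rspan (range mpoly_const) (splittings F i)"
    unfolding hc_mult by (intro rspan_sum closed_ring_consts) auto
qed

text \<open>A product of unbounded fan-in is replaced by binary ones: the partial products join
  \<open>F\<close>, at most one for each factor.\<close>

lemma splits_prod:
  assumes "finite A" "A \<noteq> {}" "splits F" "F \<subseteq> supp (over V)" "\<And>x. x \<in> A \<Longrightarrow> u x \<in> F"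
  shows "\<exists>F'. F \<subseteq> F' \<and> prod u A \<in> F' \<and> splits F' \<and> F' \<subseteq> supp (over V) \<and> card F' \<le> card F + card A"
  using assms(1,2,5)
proof (induction A rule: finite_ne_induct)
  case (singleton x)
  then show ?case using assms(3,4) by (intro exI[of _ F]) auto
next
  case (insert x A)
  then obtain F' where F': "F \<subseteq> F'" "prod u A \<in> F'" "splits F'" "F' \<subseteq> supp (over V)" "card F' \<le> card F + card A"
    by auto
  have "card (insert (u x * prod u A) F') \<le> Suc (card F')"
    by (rule card_insert_le_m1) auto
  moreover have "splits (insert (u x * prod u A) F')"
    using F' insert.prems by (intro splits_mult) auto
  moreover have "u x * prod u A \<in> supp (over V)"
    using F' insert.prems by (intro over_mult) auto
  ultimately show ?case
    using F' insert.hyps by (intro exI[of _ "insert (u x * prod u A) F'"]) auto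
qed

text \<open>Induction over vertex sets closed under inputs, removing a last vertex. A vertex pays
  for its own polynomial, and the arcs into a product gate pay for the partial products.\<close>

lemma circuit_vertices_split:
  fixes \<Gamma> :: "'a::comm_ring_1 circuit"
  defines "G \<equiv> dag \<Gamma>"
  assumes \<Gamma>: "arithmetic_circuit n \<Gamma>"
    and f: "\<And>v. v \<in> verts G \<Longrightarrow> f v = gate_poly \<Gamma> f v (gate_at \<Gamma> v)"
    and V: "\<And>v i. v \<in> verts G \<Longrightarrow> gate_at \<Gamma> v = Var i \<Longrightarrow> i \<in> V"
  shows "A \<subseteq> verts G \<Longrightarrow> (\<And>e. e \<in> arcs G \<Longrightarrow> head G e \<in> A \<Longrightarrow> tail G e \<in> A) \<Longrightarrow>
    \<exists>F. f ` A \<subseteq> F \<and> splits F \<and> F \<subseteq> supp (over V) \<and> card F \<le> card A + card {e \<in> arcs G. head G e \<in> A}"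
proof (induction "card A" arbitrary: A)
  case 0
  have "finite (verts G)"
    using \<Gamma> by (simp add: G_def arithmetic_circuit_def fin_digraph.finite_verts)
  then have "finite A" using 0(2) by (rule finite_subset[rotated])
  then have "A = {}" using 0(1) by simp
  then show ?case by (intro exI[of _ "{}"]) (auto simp: splits_def)
next
  case (Suc k)
  have fin: "fin_digraph G" and acyc: "acyclic (arcs_ends G)"
    using \<Gamma> by (auto simp: arithmetic_circuit_def G_def)
  have finite: "finite (verts G)" "finite (arcs G)" "finite A"
    using fin_digraph.finite_verts[OF fin] fin_digraph.finite_arcs[OF fin] finite_subset[OF Suc.prems(1)] by auto
  have "finite (arcs_ends G)" using finite by (simp add: arcs_ends_def)
  then have "wf ((arcs_ends G)\<inverse>)" using acyc by (rule finite_acyclic_wf_converse)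
  moreover have "A \<noteq> {}" using Suc.hyps(2) by auto
  \<comment> \<open>No arc leads from \<open>v\<close> into \<open>A\<close>, so
    \<open>A - {v}\<close> is again closed under inputs. Such a \<open>v\<close> exists because the
    graph is finite and acyclic.\<close>
  ultimately obtain v where v: "v \<in> A" "\<And>y. (y, v) \<in> (arcs_ends G)\<inverse> \<Longrightarrow> y \<notin> A"
    by (rule wfE_min') blast
  have sink: "tail G e \<noteq> v" if "e \<in> arcs G" "head G e \<in> A" for e
    using that v(2)[of "head G e"] by (auto simp: arcs_ends_conv)
  let ?A = "A - {v}"
  have closed: "tail G e \<in> ?A" if "e \<in> arcs G" "head G e \<in> A" for e
    using Suc.prems(2)[of e] that sink by auto
  have "\<exists>F. f ` ?A \<subseteq> F \<and> splits F \<and> F \<subseteq> supp (over V) \<and> card F \<le> card ?A + card {e \<in> arcs G. head G e \<in> ?A}"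
    using Suc.hyps(2) Suc.prems v(1) closed finite by (intro Suc.hyps(1)) auto
  then obtain F where F: "f ` ?A \<subseteq> F" "splits F" "F \<subseteq> supp (over V)"
      "card F \<le> card ?A + card {e \<in> arcs G. head G e \<in> ?A}"
    by blast
  have in_arcs: "in_arcs G v = {e \<in> arcs G. head G e = v}"
    by (auto simp: in_arcs_def)
  have "{e \<in> arcs G. head G e \<in> A} = {e \<in> arcs G. head G e \<in> ?A} \<union> in_arcs G v"
    using v(1) by (auto simp: in_arcs)
  then have card_arcs: "card {e \<in> arcs G. head G e \<in> A} = card {e \<in> arcs G. head G e \<in> ?A} + card (in_arcs G v)"
    using finite by (subst card_Un_disjoint[symmetric]) (auto simp: in_arcs)
  have card_A: "card A = Suc (card ?A)"
    using finite(3) v(1) by (rule card.remove)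
  have inputs: "f (tail G e) \<in> F" if "e \<in> in_arcs G v" for e
    using that closed[of e] F(1) v(1) by (auto simp: in_arcs)
  have "\<exists>F'. F \<subseteq> F' \<and> f v \<in> F' \<and> splits F' \<and> F' \<subseteq> supp (over V) \<and> card F' \<le> Suc (card F + card (in_arcs G v))"
  proof -
    have step: ?thesis if "splits (insert (f v) F)" "f v \<in> supp (over V)"
    proof (intro exI conjI)
      show "card (insert (f v) F) \<le> Suc (card F + card (in_arcs G v))"
        by (rule card_insert_le_m1) auto
    qed (use that F(3) in auto)
    have v': "v \<in> verts G" using v(1) Suc.prems(1) by auto
    have "if in_arcs G v = {}
        then (\<exists>a. gate_at \<Gamma> v = Const a) \<or> (\<exists>i\<in>{1..n}. gate_at \<Gamma> v = Var i)
        else gate_at \<Gamma> v \<in> {Plus, Times}"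
      using \<Gamma> v' unfolding arithmetic_circuit_def G_def by blast
    then consider (const) a where "gate_at \<Gamma> v = Const a" | (var) i where "gate_at \<Gamma> v = Var i"
      | (plus) "gate_at \<Gamma> v = Plus" | (times) "gate_at \<Gamma> v = Times" "in_arcs G v \<noteq> {}"
      by (auto split: if_splits)
    then show ?thesis
    proof cases
      case const
      then have "f v = mpoly_const a" using f[OF v'] by simp
      then show ?thesis
        by (intro step splits_leaf[OF F(2), of _ V]) (simp_all add: mpoly_const_supp)
    next
      case var
      then have "f v = mpoly_var i" using f[OF v'] by simp
      then have "f v \<in> supp (mons V 1)"
        using V[OF v' var] mpoly_var_supp by simp
      then show ?thesis
        using supp_mono[of "mons V 1" "over V"]
        by (intro step splits_leaf[OF F(2), of _ V]) (auto simp: mons_def mons_imp_mons_le)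
    next
      case plus
      then have eq: "f v = (\<Sum>e\<in>in_arcs G v. f (tail G e))"
        using f[OF v'] by (simp add: G_def)
      show ?thesis
        unfolding eq[symmetric]
      proof (rule step)
        show "splits (insert (f v) F)"
          unfolding eq by (rule splits_sum[OF F(2) inputs])
        show "f v \<in> supp (over V)"
          unfolding eq using inputs F(3) by (intro supp_sum) auto
      qed
    next
      case times
      have "finite (in_arcs G v)" using finite by (simp add: in_arcs)
      then obtain F' where "F \<subseteq> F'" "(\<Prod>e\<in>in_arcs G v. f (tail G e)) \<in> F'" "splits F'"
          "F' \<subseteq> supp (over V)" "card F' \<le> card F + card (in_arcs G v)"
        using splits_prod[OF _ times(2) F(2,3), of "\<lambda>e. f (tail G e)"] inputs by auto
      then show ?thesis
        using f[OF v'] times(1) by (intro exI[of _ F']) (auto simp: G_def)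
    qed
  qed
  then obtain F' where F': "F \<subseteq> F'" "f v \<in> F'" "splits F'" "F' \<subseteq> supp (over V)"
      "card F' \<le> Suc (card F + card (in_arcs G v))"
    by blast
  then show ?case
    using F(1,4) card_arcs card_A by (intro exI[of _ F']) auto
qed

lemma circuit_splits:
  fixes \<Gamma> :: "'a::comm_ring_1 circuit"
  assumes \<Gamma>: "arithmetic_circuit n \<Gamma>" and p: "computes \<Gamma> p"
  shows "\<exists>V F. V \<subseteq> {1..n} \<and> card V \<le> circuit_size \<Gamma> \<and> splits F \<and> F \<subseteq> supp (over V) \<and> p \<in> F \<and> card F \<le> circuit_size \<Gamma>"
proof -
  define G where "G = dag \<Gamma>"
  \<comment> \<open>Only variables that label some vertex are kept, which bounds their number by the
    number of vertices.\<close>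
  define V where "V = {i \<in> {1..n}. \<exists>v\<in>verts G. gate_at \<Gamma> v = Var i}"
  obtain f where f: "\<forall>v\<in>verts G. f v = gate_poly \<Gamma> f v (gate_at \<Gamma> v)" "f (out \<Gamma>) = p"
    using p by (auto simp: computes_def G_def)
  have fin: "fin_digraph G" using \<Gamma> by (auto simp: arithmetic_circuit_def G_def)
  have finite: "finite (verts G)" using fin_digraph.finite_verts[OF fin] .
  have V: "i \<in> V" if "v \<in> verts G" "gate_at \<Gamma> v = Var i" for v i
    using \<Gamma> that unfolding arithmetic_circuit_def V_def G_def
    by (metis (mono_tags, lifting) gate.distinct gate.inject(2) insertE singletonD mem_Collect_eq)
  have "\<exists>F. f ` verts G \<subseteq> F \<and> splits F \<and> F \<subseteq> supp (over V) \<and>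
      card F \<le> card (verts G) + card {e \<in> arcs G. head G e \<in> verts G}"
    using circuit_vertices_split[OF \<Gamma>, of f V "verts (dag \<Gamma>)"] f(1) V fin_digraph.axioms(1)[OF fin]
    by (auto simp: G_def wf_digraph.tail_in_verts)
  moreover have "{e \<in> arcs G. head G e \<in> verts G} = arcs G"
    using wf_digraph.head_in_verts[OF fin_digraph.axioms(1)[OF fin]] by auto
  ultimately obtain F where F: "f ` verts G \<subseteq> F" "splits F" "F \<subseteq> supp (over V)" "card F \<le> circuit_size \<Gamma>"
    by (auto simp: circuit_size_def G_def)
  have "V \<subseteq> (\<lambda>v. case gate_at \<Gamma> v of Var i \<Rightarrow> i | _ \<Rightarrow> 0) ` verts G"
    by (force simp: V_def image_iff)
  then have "card V \<le> card (verts G)"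
    using finite by (rule surj_card_le[rotated])
  moreover have "p \<in> F"
    using F(1) f(2) \<Gamma> by (auto simp: arithmetic_circuit_def G_def)
  ultimately show ?thesis
    using F by (intro exI[of _ V] exI[of _ F]) (auto simp: circuit_size_def G_def V_def)
qed

section \<open>Cutting at a degree threshold\<close>

text \<open>The sum \<open>j + k\<close> is not tied to the degree of the component being cut, since
  the cofactor supplies the rest; the size of the family therefore depends only on \<open>F\<close>
  and the threshold.\<close>

definition cut_products :: "'a::comm_ring_1 mpoly set \<Rightarrow> nat \<Rightarrow> 'a mpoly set" where
  "cut_products F \<tau> = (\<lambda>(a, b, j, k). hc j a * hc k b) `
     {(a, b, j, k). a \<in> F \<and> b \<in> F \<and> j < \<tau> \<and> k < \<tau> \<and> \<tau> \<le> j + k}"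

lemma finite_card_cut_products:
  assumes "finite F"
  shows "finite (cut_products F \<tau>) \<and> card (cut_products F \<tau>) \<le> (card F * \<tau>)\<^sup>2"
proof -
  let ?f = "\<lambda>(a, b, j, k). hc j a * hc k b"
  have sub: "cut_products F \<tau> \<subseteq> ?f ` (F \<times> F \<times> {..<\<tau>} \<times> {..<\<tau>})"
    unfolding cut_products_def by (intro image_mono) auto
  have fin: "finite (F \<times> F \<times> {..<\<tau>} \<times> {..<\<tau>})"
    using assms by auto
  have "card (cut_products F \<tau>) \<le> card (F \<times> F \<times> {..<\<tau>} \<times> {..<\<tau>})"
    using card_mono[OF finite_imageI[OF fin] sub] card_image_le[OF fin, of ?f] by linarith
  then show ?thesis
    using finite_subset[OF sub finite_imageI[OF fin]]
    by (simp add: card_cartesian_product power2_eq_square algebra_simps)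
qed

text \<open>
  Following the factor of larger degree down the computation of a component of degree
  \<open>i \<ge> \<tau>\<close>, there is a last product gate of degree at least \<open>\<tau>\<close>. The summands are grouped
  by the two factors of this gate.
\<close>

lemma hc_cut:
  assumes F: "splits F" "F \<subseteq> supp (over V)" and \<tau>: "\<tau> \<ge> 2"
  shows "f \<in> F \<Longrightarrow> i \<ge> \<tau> \<Longrightarrow> hc i f \<in> rspan (supp (over V)) (cut_products F \<tau>)"
proof (induction i arbitrary: f rule: less_induct)
  case (less i)
  let ?S = "rspan (supp (over V)) (cut_products F \<tau>)"
  have "range mpoly_const \<subseteq> supp (over V)"
    by (auto intro: mpoly_const_supp)
  then have "hc i f \<in> rspan (supp (over V)) (splittings F i)"
    using splitsD[OF F(1) less.prems(1), of i] less.prems(2) \<tau> unfolding rspan_def by fastforce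
  then show ?case
  proof (rule rspan_trans[OF closed_ring_over])
    fix g assume "g \<in> splittings F i"
    then obtain a b j where g: "g = hc j a * hc (i - j) b" "a \<in> F" "b \<in> F" "0 < j" "j < i"
      by (auto simp: splittings_def)
    have over: "hc k c \<in> supp (over V)" if "c \<in> F" for k c
      using hc_supp[of c V k] that F(2) supp_mono[of "mons V k" "over V"] by (auto simp: mons_def)
    \<comment> \<open>A factor still at or above the threshold is followed further, the other one
      joining the coefficient. If both are below it, this is the gate sought, as their degrees add
      up to \<open>i\<close>.\<close>
    consider "j \<ge> \<tau>" | "i - j \<ge> \<tau>" | "j < \<tau>" "i - j < \<tau>" by linarith
    then show "g \<in> ?S"
    proof cases
      case 1
      have "hc (i - j) b * hc j a \<in> ?S"
        using less.IH[of j a] 1 g by (intro rspan_scale[OF closed_ring_over] over) auto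
      then show ?thesis by (simp add: g mult.commute)
    next
      case 2
      then show ?thesis
        unfolding g(1) using less.IH[of "i - j" b] g by (intro rspan_scale[OF closed_ring_over] over) auto
    next
      case 3
      then have "g \<in> cut_products F \<tau>"
        unfolding cut_products_def using g less.prems(2) by (intro image_eqI[of _ _ "(a, b, j, i - j)"]) auto
      moreover have "finite (cut_products F \<tau>)"
        using F(1) finite_card_cut_products by (auto simp: splits_def)
      ultimately show ?thesis
        by (intro rspan_base closed_ring_over)
    qed
  qed
qed

lemma approx_sum:
  "finite A \<Longrightarrow> (\<And>x. x \<in> A \<Longrightarrow> approx V d M F (u x)) \<Longrightarrow> approx V d (card A * M) F (sum u A)"
proof (induction A rule: finite_induct)
  case (insert x A)
  then show ?case using approx_add[of V d M F "u x" "card A * M" "sum u A"] by simp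
qed (simp add: approx_0)

text \<open>
  Each cut leaves a cofactor of degree at most \<open>k\<close> and two components of degree less than
  \<open>i - k\<close>, so that at most \<open>i div k - 1\<close> cuts bring all degrees down to \<open>2k\<close>.
\<close>

lemma approx_hc:
  fixes d :: nat
  assumes F: "splits F" "F \<subseteq> supp (over V)" and V: "finite V" and k: "k \<ge> 1"
  defines "T \<equiv> (card F * d)\<^sup>2" and "B \<equiv> 1 + 2 * k * card (mons_le V (2 * k))"
  shows "f \<in> F \<Longrightarrow> i \<le> d \<Longrightarrow>
    approx V i (2 * (8 * T) ^ (i div k - 1)) ((1 + 2 * (i div k - 1)) * B) (hc i f)"
proof (induction i arbitrary: f rule: less_induct)
  case (less i)
  have fin: "finite F" using F(1) by (simp add: splits_def)
  have over: "c \<in> supp (over V)" if "c \<in> F" for c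
    using that F(2) by blast
  define q where "q = i div k - 1"
  show ?case
  proof (cases "i \<le> 2 * k")
    case True
    have "approx V i 2 B (hc i f)"
      unfolding B_def by (rule approx_form[OF V hc_supp[OF over] True]) fact
    \<comment> \<open>No cut is made here, but at \<open>i = 2 * k\<close> the exponent
      \<open>q\<close> is already 1, so the claimed fan-in is at least 2 only if \<open>T\<close> is
      positive.\<close>
    moreover have "T \<ge> 1" if "q > 0"
    proof -
      have "i > 0" using that by (cases i) (auto simp: q_def)
      moreover have "card F > 0" using less.prems fin card_gt_0_iff by blast
      ultimately show ?thesis using less.prems unfolding T_def by (cases d) auto
    qed
    then have "2 \<le> 2 * (8 * T) ^ q" by (cases "q = 0") auto
    ultimately show ?thesis
      unfolding q_def[symmetric] by (rule approx_mono) simp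
  next
    case False
    define G where "G = cut_products F (i - k)"
    have G: "finite G" "card G \<le> T"
    proof -
      have "(card F * (i - k))\<^sup>2 \<le> T"
        unfolding T_def using less.prems by (intro power_mono mult_le_mono) auto
      then show "finite G" "card G \<le> T"
        using finite_card_cut_products[OF fin, of "i - k"] by (auto simp: G_def)
    qed
    have "hc i f \<in> rspan (supp (over V)) G"
      unfolding G_def using False less.prems k by (intro hc_cut F) auto
    then obtain Y where Y: "\<forall>g\<in>G. Y g \<in> supp (over V)" "hc i f = (\<Sum>g\<in>G. Y g * g)"
      unfolding rspan_def by blast
    \<comment> \<open>The cofactors \<open>Y g\<close> need not be homogeneous. Taking the component
      of degree \<open>i\<close> once more keeps only their relevant part.\<close>
    have "hc i (hc i f) = hc i f"
      using hc_homogeneous[OF hc_supp[OF over], of f i i] less.prems by simp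
    then have "hc i f = (\<Sum>g\<in>G. hc i (Y g * g))"
      using Y(2) by (simp add: hc_sum)
    moreover have "approx V i (8 * (8 * T) ^ (q - 1)) ((1 + 2 * q) * B) (hc i (Y g * g))" if "g \<in> G" for g
    proof -
      obtain a b j l where g: "g = hc j a * hc l b" "a \<in> F" "b \<in> F" "j < i - k" "l < i - k" "i - k \<le> j + l"
        using \<open>g \<in> G\<close> by (auto simp: G_def cut_products_def)
      have hom: "hc j a \<in> supp (mons V j)" "hc l b \<in> supp (mons V l)"
        using g over hc_supp by auto
      then have g_hom: "g \<in> supp (mons V (j + l))"
        unfolding g(1) by (rule mons_mult)
      show ?thesis
      proof (cases "j + l \<le> i")
        case True
        define q1 where "q1 = j div k - 1"
        define q2 where "q2 = l div k - 1"
        \<comment> \<open>If both quotients \<open>j div k\<close> and \<open>l div k\<close> are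
          positive, their sum is at most \<open>i div k\<close> and two units are subtracted. If one
          is 0, the other is at most \<open>i div k - 1\<close> because \<open>j\<close> and
          \<open>l\<close> are below \<open>i - k\<close>.\<close>
        have qs: "q1 + q2 + 1 \<le> q"
        proof -
          have i2: "2 \<le> i div k"
            using False k by (simp add: less_eq_div_iff_mult_less_eq)
          have sub: "j div k + 1 \<le> i div k" "l div k + 1 \<le> i div k"
          proof -
            have "(j + k) div k \<le> i div k" "(l + k) div k \<le> i div k"
              using g by (auto intro!: div_le_mono)
            then show "j div k + 1 \<le> i div k" "l div k + 1 \<le> i div k"
              using k by auto
          qed
          have "j div k + l div k \<le> (j + l) div k"
            using k by (simp add: less_eq_div_iff_mult_less_eq algebra_simps add_mono)
          then have "j div k + l div k \<le> i div k"
            using div_le_mono[OF True, of k] by linarith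
          then show ?thesis
            using i2 sub unfolding q1_def q2_def q_def by linarith
        qed
        \<comment> \<open>As \<open>j + l\<close> is at least \<open>i - k\<close>, the cofactor has
          degree at most \<open>k\<close> and falls under the bound \<open>B\<close>.\<close>
        have "approx V (i - (j + l)) 2 B (hc (i - (j + l)) (Y g))"
          unfolding B_def using g Y(1) \<open>g \<in> G\<close> by (intro approx_form V hc_supp) auto
        moreover have "approx V j (2 * (8 * T) ^ q1) ((1 + 2 * q1) * B) (hc j a)"
            "approx V l (2 * (8 * T) ^ q2) ((1 + 2 * q2) * B) (hc l b)"
          unfolding q1_def q2_def using g less.prems by (intro less.IH; simp)+
        then have "approx V (j + l) ((2 * (8 * T) ^ q1) * (2 * (8 * T) ^ q2))
            ((1 + 2 * q1) * B + (1 + 2 * q2) * B) g"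
          unfolding g(1) by (intro approx_mult hom)
        ultimately have "approx V (i - (j + l) + (j + l)) (2 * ((2 * (8 * T) ^ q1) * (2 * (8 * T) ^ q2)))
            (B + ((1 + 2 * q1) * B + (1 + 2 * q2) * B)) (hc (i - (j + l)) (Y g) * g)"
          using Y(1) \<open>g \<in> G\<close> by (intro approx_mult g_hom hc_supp) auto
        moreover have "hc i (Y g * g) = hc (i - (j + l)) (Y g) * g"
          using True hc_mult_homogeneous[OF g_hom] by simp
        \<comment> \<open>The cofactor and the two parts contribute a factor 2 each. With at most
          \<open>T\<close> summands this makes \<open>8 * T\<close> for each cut.\<close>
        moreover have "2 * ((2 * (8 * T) ^ q1) * (2 * (8 * T) ^ q2)) \<le> 8 * (8 * T) ^ (q - 1)"
        proof -
          have "card G > 0" using G(1) \<open>g \<in> G\<close> card_gt_0_iff by blast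
          then have "(8 * T) ^ (q1 + q2) \<le> (8 * T) ^ (q - 1)"
            using qs G(2) by (intro power_increasing) auto
          then show ?thesis by (simp add: power_add)
        qed
        \<comment> \<open>After \<open>q\<close> cuts at most \<open>1 + 2 * q\<close> low-degree
          pieces are multiplied, each of formal degree at most \<open>B\<close>.\<close>
        moreover have "B + ((1 + 2 * q1) * B + (1 + 2 * q2) * B) \<le> (1 + 2 * q) * B"
        proof -
          have "B + ((1 + 2 * q1) * B + (1 + 2 * q2) * B) = (1 + 2 * (q1 + q2 + 1)) * B"
            by (simp add: algebra_simps)
          also have "\<dots> \<le> (1 + 2 * q) * B"
            using qs by (intro mult_le_mono) auto
          finally show ?thesis .
        qed
        ultimately show ?thesis
          using True by (auto elim: approx_mono)
      next
        case False
        then show ?thesis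
          using hc_mult_homogeneous[OF g_hom, of i "Y g"] by (simp add: approx_0)
      qed
    qed
    ultimately have "approx V i (card G * (8 * (8 * T) ^ (q - 1))) ((1 + 2 * q) * B) (hc i f)"
      using approx_sum[OF G(1)] by simp
    moreover have "q \<ge> 1"
    proof -
      have "2 \<le> i div k"
        using False k by (simp add: less_eq_div_iff_mult_less_eq)
      then show ?thesis by (simp add: q_def)
    qed
    then have "(8 * T) ^ q = 8 * T * (8 * T) ^ (q - 1)"
      by (cases q) auto
    then have "card G * (8 * (8 * T) ^ (q - 1)) \<le> 2 * (8 * T) ^ q"
      using G(2) mult_le_mono1[OF G(2), of "8 * (8 * T) ^ (q - 1)"] by (simp add: algebra_simps)
    ultimately show ?thesis
      unfolding q_def[symmetric] by (rule approx_mono) simp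
  qed
qed

section \<open>Parameters\<close>

lemma exp_half_le_2: "exp (1/2 :: real) \<le> 2"
proof (rule power2_le_imp_le)
  have "(exp (1/2))\<^sup>2 = exp (1 :: real)"
    by (simp add: power2_eq_square flip: exp_add)
  then show "(exp (1/2 :: real))\<^sup>2 \<le> 2\<^sup>2"
    using exp_le by simp
qed simp

text \<open>With \<open>u\<close> the fourth root of \<open>d\<close>, the hypothesis says
  \<open>s < u\<close>. Then \<open>d + 1\<close> is at most \<open>exp (5 * u)\<close> and
  \<open>s + 1\<close> at most \<open>2 * u\<close>, giving \<open>exp (10 * sqrt d)\<close>;
  passing to base \<open>s\<close>, which is at least \<open>exp (1/2)\<close>, doubles the
  exponent.\<close>

lemma power_Suc_le_powr_sqrt:
  fixes s d :: nat
  assumes s: "2 \<le> s" and d: "s ^ 4 < d"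
  shows "real ((d + 1) ^ (s + 1)) \<le> real s powr (20 * sqrt d)"
proof -
  define u where "u = sqrt (sqrt (real d))"
  have u2: "u\<^sup>2 = sqrt d" by (simp add: u_def)
  have "(u\<^sup>2)\<^sup>2 = d" by (simp only: u2) simp
  then have u4: "u ^ 4 = d" by simp
  have "real s ^ 4 < u ^ 4"
    unfolding u4 using d by (metis of_nat_less_iff of_nat_power)
  then have su: "real s < u"
    by (rule power_less_imp_less_base) (simp add: u_def)
  have u: "u > 2" using su s by linarith
  have "u \<le> exp u" using exp_ge_add_one_self[of u] by linarith
  then have "u ^ 4 \<le> exp u ^ 4" using u by (intro power_mono) auto
  moreover have "2 \<le> exp u" using exp_ge_add_one_self[of u] u by linarith
  ultimately have "2 * u ^ 4 \<le> exp u * exp u ^ 4"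
    by (intro mult_mono) auto
  also have "\<dots> = exp (5 * u)"
    by (simp add: exp_of_nat_mult[of 5 u, simplified] eval_nat_numeral)
  finally have "real (d + 1) \<le> exp (5 * u)"
    using u4 d by simp
  then have "real (d + 1) ^ (s + 1) \<le> exp (5 * u) ^ (s + 1)"
    by (intro power_mono) auto
  also have "\<dots> = exp (real (s + 1) * (5 * u))"
    by (rule exp_of_nat_mult[symmetric])
  also have "\<dots> \<le> exp (10 * u\<^sup>2)"
  proof -
    have "real (s + 1) * (5 * u) \<le> (2 * u) * (5 * u)"
      using su u by (intro mult_right_mono) auto
    then show ?thesis by (simp add: power2_eq_square)
  qed
  also have "\<dots> = exp (1/2) powr (20 * sqrt d)"
    by (simp add: u2 powr_def)
  also have "\<dots> \<le> real s powr (20 * sqrt d)"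
    using exp_half_le_2 s by (intro powr_mono2) auto
  finally show ?thesis by (simp only: of_nat_power)
qed

lemma nat_power_le_powr:
  assumes "m \<le> s ^ k" "1 \<le> s" "real k \<le> x"
  shows "real m \<le> real s powr x"
proof -
  have "real m \<le> real s ^ k" using assms(1) by (metis of_nat_le_iff of_nat_power)
  also have "\<dots> = real s powr real k" using assms(2) by (simp add: powr_realpow)
  also have "\<dots> \<le> real s powr x" using assms by (intro powr_mono) auto
  finally show ?thesis .
qed

text \<open>Cutting with \<open>k\<close> about \<open>d / t\<close> needs at most
  \<open>t - 1\<close> cuts. Since \<open>d\<close> is polynomial in \<open>s\<close>, each cut
  multiplies the fan-in by a fixed power of \<open>s\<close>, and the low-degree pieces have
  \<open>s\<close> to the \<open>O(k)\<close> monomials.\<close>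

lemma approx_low_degree:
  fixes s d t :: nat
  assumes F: "splits F" "F \<subseteq> supp (over V)" "p \<in> F" "card F \<le> s"
    and V: "finite V" "card V \<le> s" and p: "p \<in> supp (mons V d)"
    and s: "2 \<le> s" "d \<le> s ^ 4" and t: "t \<in> {1..d}"
  shows "\<exists>M N. approx V d M N p \<and> real M \<le> real s powr (20 * real t) \<and> real N \<le> real s powr (20 * (d / t))"
proof -
  \<comment> \<open>This is \<open>d / t\<close> rounded up: rounding up gives
    \<open>d div k \<le> t\<close>, and \<open>t \<le> d\<close> keeps \<open>k\<close> below
    \<open>2 * (d / t)\<close>.\<close>
  define k where "k = (d + t - 1) div t"
  define T where "T = (card F * d)\<^sup>2"
  define B where "B = 1 + 2 * k * card (mons_le V (2 * k))"
  define q where "q = d div k - 1"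
  have k1: "k \<ge> 1" using t by (auto simp: k_def less_eq_div_iff_mult_less_eq)
  have "k * t + (d + t - 1) mod t = d + t - 1" "(d + t - 1) mod t < t"
    unfolding k_def using t by (auto simp: div_mult_mod_eq)
  then have kt: "d \<le> k * t" "k * t \<le> 2 * d"
    using t by auto
  have "d div k \<le> t"
    using div_le_mono[OF kt(1), of k] k1 by simp
  then have q: "q + 1 \<le> t"
    using t by (auto simp: q_def)
  have "approx V d (2 * (8 * T) ^ q) ((1 + 2 * q) * B) (hc d p)"
    unfolding q_def T_def B_def using F V k1 by (intro approx_hc) auto
  moreover have "hc d p = p" using hc_homogeneous[OF p, of d] by simp
  moreover have "real (2 * (8 * T) ^ q) \<le> real s powr (20 * real t)"
  proof (rule nat_power_le_powr)
    have "T \<le> (s * s ^ 4)\<^sup>2"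
      unfolding T_def using F(4) s by (intro power_mono mult_le_mono) auto
    also have "\<dots> = s ^ 10" by (simp add: eval_nat_numeral)
    finally have "8 * T \<le> s ^ 3 * s ^ 10"
      using power_mono[OF s(1), of 3] by (intro mult_le_mono) auto
    also have "\<dots> = s ^ 13" by (simp flip: power_add)
    finally have "(8 * T) ^ q \<le> (s ^ 13) ^ q" by (rule power_mono) simp
    then have "2 * (8 * T) ^ q \<le> s * (s ^ 13) ^ q"
      using s by (intro mult_le_mono) auto
    also have "\<dots> = s ^ (1 + 13 * q)" by (simp flip: power_mult)
    finally show "2 * (8 * T) ^ q \<le> s ^ (1 + 13 * q)" .
    show "real (1 + 13 * q) \<le> 20 * real t" using q by linarith
  qed (use s in auto)
  moreover have "real ((1 + 2 * q) * B) \<le> real s powr (20 * (d / t))"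
  proof (rule nat_power_le_powr)
    have "s + 1 \<le> s * s" using mult_le_mono1[OF s(1), of s] s by linarith
    then have "(s + 1) ^ (2 * k) \<le> (s * s) ^ (2 * k)" by (rule power_mono) simp
    also have "\<dots> = s ^ (4 * k)" by (simp add: power_mult_distrib flip: power_add)
    finally have "card (mons_le V (2 * k)) \<le> s ^ (4 * k)"
      using finite_card_mons_le_length[OF V(1), of "2 * k"] power_mono[of "card V + 1" "s + 1" "2 * k"] V(2)
      by linarith
    then have "2 * k * card (mons_le V (2 * k)) \<le> 2 * k * s ^ (4 * k)" by simp
    moreover have "1 \<le> k * s ^ (4 * k)" using k1 s by simp
    ultimately have "B \<le> 4 * (k * s ^ (4 * k))"
      unfolding B_def by linarith
    then have "(1 + 2 * q) * B \<le> (2 * t) * (4 * (k * s ^ (4 * k)))"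
      using q by (intro mult_le_mono) auto
    also have "\<dots> = 8 * (k * t) * s ^ (4 * k)" by simp
    \<comment> \<open>Here \<open>k * t \<le> 2 * d\<close> meets \<open>d \<le> s ^ 4\<close>; the
      remaining constant 16 is absorbed by another \<open>s ^ 4\<close>.\<close>
    also have "\<dots> \<le> 8 * (2 * s ^ 4) * s ^ (4 * k)"
      by (rule mult_le_mono1, rule mult_le_mono2) (use kt s in linarith)
    also have "\<dots> = 2 ^ 4 * s ^ (4 + 4 * k)" by (simp add: power_add)
    also have "\<dots> \<le> s ^ 4 * s ^ (4 + 4 * k)"
      using s by (intro mult_le_mono power_mono) auto
    also have "\<dots> = s ^ (8 + 4 * k)" by (simp flip: power_add)
    finally show "(1 + 2 * q) * B \<le> s ^ (8 + 4 * k)" .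
    have "real k * real t \<le> 2 * real d" using kt(2) by (metis of_nat_le_iff of_nat_mult of_nat_numeral)
    then have "real k \<le> 2 * (d / t)" using t by (simp add: field_simps)
    moreover have "1 \<le> real d / t" using t by simp
    ultimately show "real (8 + 4 * k) \<le> 20 * (d / t)" by simp
  qed (use s in auto)
  ultimately show ?thesis by metis
qed

text \<open>One of \<open>t\<close> and \<open>d / t\<close> is at least \<open>sqrt d\<close>, and
  its power of \<open>s\<close> absorbs the count of monomials: as top fan-in of the exact sum of
  monomials, or as formal degree of the two-gate approximation.\<close>

lemma approx_high_degree:
  fixes s d t :: nat
  assumes V: "finite V" "card V \<le> s" and p: "p \<in> supp (mons V d)"
    and s: "2 \<le> s" "s ^ 4 < d" and t: "t \<in> {1..d}"
  shows "\<exists>M N. approx V d M N p \<and> real M \<le> real s powr (20 * real t) \<and>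
    real N \<le> max (real d) (real s powr (20 * (d / t)))"
proof -
  have "card (mons_le V d) \<le> (d + 1) ^ card V" by (rule card_mons_le_box[OF V(1)])
  also have "\<dots> \<le> (d + 1) ^ s" using V(2) by (intro power_increasing) auto
  finally have card: "card (mons_le V d) \<le> (d + 1) ^ s" .
  show ?thesis
  proof (cases "sqrt d \<le> t")
    case True
    have "card (mons V d) \<le> card (mons_le V d)"
      using V by (intro card_mono finite_mons_le) (auto simp: mons_defs)
    also have "\<dots> \<le> (d + 1) ^ (s + 1)" using card by simp
    finally have "real (card (mons V d)) \<le> real ((d + 1) ^ (s + 1))"
      by (rule of_nat_mono)
    also have "\<dots> \<le> real s powr (20 * sqrt d)" by (rule power_Suc_le_powr_sqrt[OF s])
    also have "\<dots> \<le> real s powr (20 * real t)" using True s by (intro powr_mono) auto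
    finally show ?thesis
      using approx_monomials[OF V(1) _ p] t by (intro exI[of _ "card (mons V d)"] exI[of _ d]) auto
  next
    case False
    have "1 + d * card (mons_le V d) \<le> 1 + d * (d + 1) ^ s" using card by simp
    also have "\<dots> \<le> (d + 1) ^ (s + 1)" by simp
    finally have "real (1 + d * card (mons_le V d)) \<le> real ((d + 1) ^ (s + 1))"
      by (rule of_nat_mono)
    also have "\<dots> \<le> real s powr (20 * sqrt d)" by (rule power_Suc_le_powr_sqrt[OF s])
    also have "\<dots> \<le> real s powr (20 * (d / t))"
    proof -
      have "sqrt d * t \<le> sqrt d * sqrt d" using False by (intro mult_left_mono) auto
      then have "sqrt d \<le> d / t" using t by (simp add: field_simps)
      then show ?thesis using s by (intro powr_mono) auto
    qed
    finally have "real (1 + d * card (mons_le V d)) \<le> max (real d) (real s powr (20 * (d / t)))"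
      by simp
    moreover have "real 2 \<le> real s powr (20 * real t)"
      using s t by (intro nat_power_le_powr[where k = 1]) auto
    ultimately show ?thesis
      using approx_homogeneous[OF V(1) _ p] t by (intro exI[of _ 2] exI[of _ "1 + d * card (mons_le V d)"]) auto
  qed
qed

section \<open>From approximations to the circuits of the theorem\<close>

lemma approx_depth3_circuit:
  assumes "approx V d M N p" "V \<subseteq> {1..n}"
  shows "\<exists>C. depth3_circuit n C \<and> top_fanin C \<le> M \<and> formal_degree C \<le> N \<and>
    (\<exists>Q. Q \<in> mpolys n \<and> (\<forall>m\<in>Poly_Mapping.keys Q. mdeg m > d) \<and>
      depth3_poly C = lift_const p + mpoly_const eps * lift_eps Q)"
proof -
  obtain C Q where C: "\<forall>g\<in>set C. set g \<subseteq> supp (mons_le V 1) \<and> length g \<le> N" "length C \<le> M"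
     "Q \<in> supp (mons_ge V (Suc d))" "depth3_poly C = lift_eps (embed p + eps_poly * Q)"
    using assms(1) unfolding approx_def by blast
  have "affine_form n l" if "l \<in> supp (mons_le V 1)" for l :: "complex poly fract mpoly"
    using that assms(2) by (auto simp: affine_form_def mpolys_eq supp_def mons_defs)
  then have "depth3_circuit n C"
    using C(1) by (auto simp: depth3_circuit_def)
  moreover have "formal_degree C \<le> N"
    using C(1) by (auto simp: formal_degree_def)
  moreover have "Q \<in> mpolys n" "\<forall>m\<in>Poly_Mapping.keys Q. mdeg m > d"
    using C(3) assms(2) by (auto simp: mpolys_eq supp_def mons_defs)
  moreover have "depth3_poly C = lift_const p + mpoly_const eps * lift_eps Q"
    unfolding C(4) lift_const_eq lift_eps_eps_poly[symmetric] lift_eps_def frac.map_add frac.map_mult ..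
  ultimately show ?thesis
    using C(2) unfolding top_fanin_def by blast
qed

theorem theorem1p5:
  "\<exists>a b :: real. a > 0 \<and> b > 0 \<and>
     (\<forall>(n::nat) (d::nat) (s::nat) (P :: complex mpoly).
        P \<in> mpolys n \<longrightarrow> homogeneous d P \<longrightarrow>
        (\<exists>\<Gamma> :: complex circuit. arithmetic_circuit n \<Gamma> \<and> circuit_size \<Gamma> = s \<and> computes \<Gamma> P) \<longrightarrow>
        (\<forall>t\<in>{1..d}. \<exists>C :: complex poly fract depth3.
           depth3_circuit n C \<and>
           real (top_fanin C) \<le> real s powr (a * real t) \<and>
           real (formal_degree C) \<le> max (real d) (real s powr (b * (real d / real t))) \<and>
           (\<exists>Q :: complex poly mpoly. Q \<in> mpolys n \<and>
              (\<forall>m\<in>Poly_Mapping.keys Q. mdeg m > d) \<and>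
              depth3_poly C = lift_const P + mpoly_const eps * lift_eps Q)))"
proof (intro exI[of _ 20] conjI allI impI ballI)
  fix n d s t :: nat and P :: "complex mpoly"
  assume hom: "homogeneous d P" and t: "t \<in> {1..d}"
    and "\<exists>\<Gamma> :: complex circuit. arithmetic_circuit n \<Gamma> \<and> circuit_size \<Gamma> = s \<and> computes \<Gamma> P"
  then obtain V F where V: "V \<subseteq> {1..n}" "card V \<le> s"
    and F: "splits F" "F \<subseteq> supp (over V)" "P \<in> F" "card F \<le> s"
    using circuit_splits by metis
  have finV: "finite V" using V(1) finite_subset by blast
  have P: "P \<in> supp (mons V d)"
    using hom F(2,3) by (auto simp: homogeneous_def supp_def mons_def)
  have "finite F" using F(1) by (simp add: splits_def)
  then have "card F > 0" using F(3) by (auto simp: card_gt_0_iff)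
  then have "s \<noteq> 0" using F(4) by linarith
  then consider "s = 1" | "2 \<le> s" "d \<le> s ^ 4" | "2 \<le> s" "s ^ 4 < d" by linarith
  then have "\<exists>M N. approx V d M N P \<and> real M \<le> real s powr (20 * real t) \<and>
      real N \<le> max (real d) (real s powr (20 * (d / t)))"
  proof cases
    \<comment> \<open>All powers of \<open>s\<close> are 1, so a single gate is allowed. There is at
      most one variable, hence at most one monomial of degree \<open>d\<close>, and its formal
      degree \<open>d\<close> is covered by the maximum.\<close>
    case 1
    have "card (mons V d) \<le> card V ^ d" by (rule card_mons_length[OF finV])
    also have "\<dots> \<le> 1" using power_mono[of "card V" 1 d] V(2) 1 by simp
    finally show ?thesis
      using approx_monomials[OF finV _ P] t 1 by (intro exI[of _ "card (mons V d)"] exI[of _ d]) auto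
  next
    case 2
    then show ?thesis
      using approx_low_degree[OF F finV V(2) P 2 t] by (meson max.coboundedI2)
  next
    case 3
    then show ?thesis by (intro approx_high_degree[OF finV V(2) P _ _ t])
  qed
  then obtain M N where MN: "approx V d M N P" "real M \<le> real s powr (20 * real t)"
      "real N \<le> max (real d) (real s powr (20 * (d / t)))"
    by blast
  obtain C where C: "depth3_circuit n C" "top_fanin C \<le> M" "formal_degree C \<le> N"
    "\<exists>Q. Q \<in> mpolys n \<and> (\<forall>m\<in>Poly_Mapping.keys Q. mdeg m > d) \<and>
      depth3_poly C = lift_const P + mpoly_const eps * lift_eps Q"
    using approx_depth3_circuit[OF MN(1) V(1)] by blast
  show "\<exists>C :: complex poly fract depth3.
           depth3_circuit n C \<and>
           real (top_fanin C) \<le> real s powr (20 * real t) \<and>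
           real (formal_degree C) \<le> max (real d) (real s powr (20 * (real d / real t))) \<and>
           (\<exists>Q :: complex poly mpoly. Q \<in> mpolys n \<and>
              (\<forall>m\<in>Poly_Mapping.keys Q. mdeg m > d) \<and>
              depth3_poly C = lift_const P + mpoly_const eps * lift_eps Q)"
    using C(1,4) order_trans[OF of_nat_mono[OF C(2)] MN(2)] order_trans[OF of_nat_mono[OF C(3)] MN(3)]
    by blast
qed auto

end
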